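(* Let $G$ be a finite group and $V$ a finite dimensional (not necessarily faithful) $\mathbb{C}G$-module. Let $g\in G$ and let $B=\{v_1,\ldots,v_n\}$ be a basis of $V$ consisting of eigenvectors for $g$. Then, as an automorphism on $\mathrm{HH}_{\bullet}(S(V),S(V)\bar g)$ (i.e. as an isomorphism from its description by the bar resolution to its description by the Koszul resolution), $(\Psi_B)_*$ is given at the chain level by $$(\Psi_B)_*(f_0\bar g\otimes f_1\otimes\cdots\otimes f_p)=\sum_{1\le i_1<\cdots<i_p\le n}f_0\Bigl(\prod_{k=1}^p{}^{s_1s_2\cdots s_{i_k-1}}(\partial_{i_k}f_k)\Bigr)\bar g\otimes v_{i_1}\wedge\cdots\wedge v_{i_p}$$ for all $f_0,f_1,\ldots,f_p\in S(V)$.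
   Context: Write ${}^gv$ for the action of $g\in G$; it extends to $S(V)$. The skew group algebra $S(V)\#G$ is $S(V)\otimes\mathbb{C}G$ with product $(a\otimes g)(b\otimes h)=a({}^gb)\otimes gh$; write $a\bar g=a\otimes g$. $S(V)\bar g$ is an $S(V)$-bimodule. Tensor and exterior products without subscript are over $\mathbb{C}$. $S(V)^e=S(V)\otimes S(V)^{op}$ is a commutative ring; an $S(V)$-bimodule $M$ is an $S(V)^e$-module via $(a\otimes b)m=amb$, and $M\otimes_{S(V)^e}-$ is formed using this module structure over the commutative ring $S(V)^e$ (so $m\otimes(a\otimes b)n=amb\otimes n$). $\mathrm{HH}_{\bullet}(S(V),M):=\operatorname{Tor}^{S(V)^e}_{\bullet}(S(V),M)$. Bar resolution of $S(V)$: $S(V)^{\otimes(p+2)}$ in degree $p\ge0$, $\delta_p(a_0\otimes\cdots\otimes a_{p+1})=\sum_{j=0}^p(-1)^ja_0\otimes\cdots\otimes a_ja_{j+1}\otimes\cdots\otimes a_{p+1}$. Koszul resolution: $S(V)^e\otimes\bigwedge^p(V)$ in degree $p\ge0$, with $S(V)^e$-linear $d_p(1\otimes1\otimes v_{j_1}\wedge\cdots\wedge v_{j_p})=\sum_{i=1}^p(-1)^{i+1}(v_{j_i}\otimes1-1\otimes v_{j_i})\otimes(v_{j_1}\wedge\cdots\wedge\hat v_{j_i}\wedge\cdots\wedge v_{j_p})$. Applying $S(V)\bar g\otimes_{S(V)^e}-$ yields complexes with terms $S(V)\bar g\otimes S(V)^{\otimes p}$ and $S(V)\bar g\otimes\bigwedge^p(V)$,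 each computing $\mathrm{HH}_{\bullet}(S(V),S(V)\bar g)$. The chain map $\Psi_B$ from the bar to the Koszul resolution: write $\underline v^{\underline\ell}=v_1^{\ell_1}\cdots v_n^{\ell_n}$. $(\Psi_B)_0$ is the identity, and for $p\ge1$, $(\Psi_B)_p$ is $S(V)^e$-linear with $$(\Psi_B)_p(1\otimes\underline v^{\underline\ell^1}\otimes\cdots\otimes\underline v^{\underline\ell^p}\otimes1)=\sum_{1\le i_1<\cdots<i_p\le n}\ \sum_{0\le a_{i_j}<\ell^j_{i_j}}\underline v^{\underline Q}\otimes\underline v^{\underline{\hat Q}}\otimes v_{i_1}\wedge\cdots\wedge v_{i_p},$$ the second sum being over all integers $a_{i_1},\ldots,a_{i_p}$ with $0\le a_{i_j}<\ell^j_{i_j}$ for all $j$; here $\underline Q_i=a_i+\ell_i^1+\cdots+\ell_i^{j-1}$ if $i=i_j$ and $\underline Q_i=\ell_i^1+\cdots+\ell_i^j$ if $i_j<i<i_{j+1}$ (with $i_0=0$, $i_{p+1}=n+1$), and $\underline{\hat Q}$ is determined by $\underline v^{\underline Q}\,\underline v^{\underline{\hat Q}}\,v_{i_1}\cdots v_{i_p}=\underline v^{\underline\ell^1}\cdots\underline v^{\underline\ell^p}$. $(\Psi_B)_*:S(V)\bar g\otimes S(V)^{\otimes\bullet}\to S(V)\bar g\otimes\bigwedge^{\bullet}(V)$ is the map obtained from $\Psi_B$ by applying $S(V)\bar g\otimes_{S(V)^e}-$. Operators: let ${}^gv_i=\epsilon_iv_i$ and let $s_i\in GL(V)$ be given by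 ${}^{s_i}v_j=v_j$ for $j\ne i$, ${}^{s_i}v_i=\epsilon_iv_i$ (so $g$ acts as $s_1\cdots s_n$). Let $\partial_i(f)=\dfrac{f-{}^{s_i}f}{v_i-{}^{s_i}v_i}$ if $\epsilon_i\ne1$, and $\partial_i=\partial/\partial v_i$ if $\epsilon_i=1$. *)

theory Defs
  imports
    Complex_Main
    "HOL-Library.Poly_Mapping"
    "HOL-Library.Product_Plus"
    "HOL-Algebra.Coset"
begin

section \<open>Modules over a group algebra\<close>

locale CG_module = group G + vector_space scale
  for G :: "('g, 'b) monoid_scheme" (structure)
    and scale :: "complex \<Rightarrow> 'v::ab_group_add \<Rightarrow> 'v" +
  fixes \<rho> :: "'g \<Rightarrow> 'v \<Rightarrow> 'v"
  assumes finite_carrier: "finite (carrier G)"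
    and action_linear: "h \<in> carrier G \<Longrightarrow> Vector_Spaces.linear scale scale (\<rho> h)"
    and action_one: "\<rho> \<one> = id"
    and action_mult: "h \<in> carrier G \<Longrightarrow> k \<in> carrier G \<Longrightarrow> \<rho> (h \<otimes> k) = \<rho> h \<circ> \<rho> k"

text \<open>The basis is \<open>v 1, \<dots>, v n\<close>; the case \<open>n = 0\<close> (the zero module) is included.\<close>

definition eigenbasis ::
  "(complex \<Rightarrow> 'v::ab_group_add \<Rightarrow> 'v) \<Rightarrow> ('v \<Rightarrow> 'v) \<Rightarrow> nat \<Rightarrow> (nat \<Rightarrow> 'v) \<Rightarrow> (nat \<Rightarrow> complex) \<Rightarrow> bool"
where
  "eigenbasis scale T n v \<epsilon> \<longleftrightarrow>
     inj_on v {1..n} \<and> \<not> module.dependent scale (v ` {1..n}) \<and>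
     module.span scale (v ` {1..n}) = UNIV \<and>
     (\<forall>i\<in>{1..n}. T (v i) = scale (\<epsilon> i) (v i))"


section \<open>The symmetric algebra\<close>

text \<open>
  The symmetric algebra of \<open>V\<close> is the polynomial algebra on the basis \<open>v 1, \<dots>, v n\<close>: a monomial
  is an exponent vector, and \<open>v i\<close> corresponds to the variable of index \<open>i\<close>.  The type \<open>pol\<close> has
  variables for all natural numbers; \<open>Sym n\<close> is the subring in the variables \<open>1, \<dots>, n\<close>.
\<close>

type_synonym mon = "nat \<Rightarrow>\<^sub>0 nat"
type_synonym pol = "mon \<Rightarrow>\<^sub>0 complex"

definition var :: "nat \<Rightarrow> pol" where
  "var i = Poly_Mapping.single (Poly_Mapping.single i 1) 1"

definition cst :: "complex \<Rightarrow> pol" where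
  "cst c = Poly_Mapping.single 0 c"

definition mons :: "nat \<Rightarrow> mon set" where
  "mons n = {\<alpha>. Poly_Mapping.keys \<alpha> \<subseteq> {1..n}}"

definition Sym :: "nat \<Rightarrow> pol set" where
  "Sym n = {f. Poly_Mapping.keys f \<subseteq> mons n}"

definition coord ::
  "(complex \<Rightarrow> 'v::ab_group_add \<Rightarrow> 'v) \<Rightarrow> nat \<Rightarrow> (nat \<Rightarrow> 'v) \<Rightarrow> 'v \<Rightarrow> nat \<Rightarrow> complex" where
  "coord scale n v x i = module.representation scale (v ` {1..n}) x (v i)"

text \<open>The inclusion of \<open>V\<close> into its symmetric algebra.\<close>

definition incl ::
  "(complex \<Rightarrow> 'v::ab_group_add \<Rightarrow> 'v) \<Rightarrow> nat \<Rightarrow> (nat \<Rightarrow> 'v) \<Rightarrow> 'v \<Rightarrow> pol" where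
  "incl scale n v x = (\<Sum>i=1..n. cst (coord scale n v x i) * var i)"

text \<open>The algebra endomorphism of the symmetric algebra extending a linear endomorphism \<open>T\<close> of \<open>V\<close>.\<close>

definition sym_ext ::
  "(complex \<Rightarrow> 'v::ab_group_add \<Rightarrow> 'v) \<Rightarrow> nat \<Rightarrow> (nat \<Rightarrow> 'v) \<Rightarrow> ('v \<Rightarrow> 'v) \<Rightarrow> pol \<Rightarrow> pol" where
  "sym_ext scale n v T f =
     (\<Sum>\<alpha>\<in>Poly_Mapping.keys f. cst (Poly_Mapping.lookup f \<alpha>) *
        (\<Prod>i=1..n. incl scale n v (T (v i)) ^ Poly_Mapping.lookup \<alpha> i))"


section \<open>The skew group algebra and its bimodule structure\<close>

text \<open>
  \<open>Poly_Mapping.single h f\<close> is \<open>f\<close> tensor \<open>h\<close>.  The parameter \<open>A\<close> is the action of the group on the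
  symmetric algebra.
\<close>

type_synonym 'g skew = "'g \<Rightarrow>\<^sub>0 pol"

definition skew_mult ::
  "('g, 'b) monoid_scheme \<Rightarrow> ('g \<Rightarrow> pol \<Rightarrow> pol) \<Rightarrow> 'g skew \<Rightarrow> 'g skew \<Rightarrow> 'g skew" where
  "skew_mult G A x y =
     (\<Sum>h\<in>Poly_Mapping.keys x. \<Sum>k\<in>Poly_Mapping.keys y.
        Poly_Mapping.single (h \<otimes>\<^bsub>G\<^esub> k)
          (Poly_Mapping.lookup x h * A h (Poly_Mapping.lookup y k)))"

text \<open>The subbimodule of all \<open>f\<close> tensor \<open>g\<close> with \<open>f\<close> in the symmetric algebra.\<close>

definition Sym_at :: "nat \<Rightarrow> 'g \<Rightarrow> 'g skew set" where
  "Sym_at n g = Poly_Mapping.single g ` Sym n"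

text \<open>
  The enveloping algebra of the symmetric algebra.  It has the pairs of monomials as a basis, and
  the convolution product on \<open>env\<close> multiplies such pairs componentwise, as it should (the symmetric
  algebra is commutative, so passing to the opposite algebra changes nothing).
\<close>

type_synonym env = "(mon \<times> mon) \<Rightarrow>\<^sub>0 complex"

text \<open>The action \<open>(a \<otimes> b) m = a m b\<close>, the products being those of the skew group algebra.\<close>

definition env_act ::
  "('g, 'b) monoid_scheme \<Rightarrow> ('g \<Rightarrow> pol \<Rightarrow> pol) \<Rightarrow> env \<Rightarrow> 'g skew \<Rightarrow> 'g skew" where
  "env_act G A e m =
     (\<Sum>(\<alpha>, \<beta>)\<in>Poly_Mapping.keys e.
        skew_mult G A
          (Poly_Mapping.single \<one>\<^bsub>G\<^esub> (Poly_Mapping.single \<alpha> (Poly_Mapping.lookup e (\<alpha>, \<beta>))))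
          (skew_mult G A m (Poly_Mapping.single \<one>\<^bsub>G\<^esub> (Poly_Mapping.single \<beta> 1))))"


section \<open>Free modules over the enveloping algebra\<close>

text \<open>
  If \<open>W\<close> is a complex vector space with basis indexed by (a subset of) \<open>'w\<close>, then the module
  \<open>env \<otimes> W\<close> consists of finitely supported functions from \<open>'w\<close> to \<open>env\<close>, and \<open>M \<otimes> W\<close>, for a space
  \<open>M\<close> of elements of the skew group algebra, of finitely supported functions from \<open>'w\<close> to \<open>M\<close>.
\<close>

definition fscale :: "'r::mult_zero \<Rightarrow> ('w \<Rightarrow>\<^sub>0 'r) \<Rightarrow> ('w \<Rightarrow>\<^sub>0 'r)" where
  "fscale c x = Poly_Mapping.map ((*) c) x"

definition free_on :: "'w set \<Rightarrow> 'm::zero set \<Rightarrow> ('w \<Rightarrow>\<^sub>0 'm) set" where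
  "free_on W M = {x. Poly_Mapping.keys x \<subseteq> W \<and> (\<forall>w. Poly_Mapping.lookup x w \<in> M)}"

text \<open>The \<open>env\<close>-linear map with prescribed values on the elements \<open>1 \<otimes> 1 \<otimes> w\<close>.\<close>

definition env_lin :: "('w \<Rightarrow> ('u \<Rightarrow>\<^sub>0 env)) \<Rightarrow> ('w \<Rightarrow>\<^sub>0 env) \<Rightarrow> ('u \<Rightarrow>\<^sub>0 env)" where
  "env_lin \<phi> x = (\<Sum>w\<in>Poly_Mapping.keys x. fscale (Poly_Mapping.lookup x w) (\<phi> w))"

text \<open>
  Under the identification of \<open>M \<otimes>\<^sub>e\<^sub>n\<^sub>v (env \<otimes> W)\<close> with \<open>M \<otimes> W\<close>, which sends
  \<open>m \<otimes> (a \<otimes> b \<otimes> w)\<close> to \<open>a m b \<otimes> w\<close>, the following is the image of the elementary tensor of \<open>m\<close> and \<open>z\<close>.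
\<close>

definition env_tensor ::
  "('g, 'b) monoid_scheme \<Rightarrow> ('g \<Rightarrow> pol \<Rightarrow> pol) \<Rightarrow> 'g skew \<Rightarrow> ('w \<Rightarrow>\<^sub>0 env) \<Rightarrow> ('w \<Rightarrow>\<^sub>0 'g skew)" where
  "env_tensor G A m z =
     (\<Sum>w\<in>Poly_Mapping.keys z. Poly_Mapping.single w (env_act G A (Poly_Mapping.lookup z w) m))"

text \<open>
  The functor \<open>M \<otimes>\<^sub>e\<^sub>n\<^sub>v -\<close> on an \<open>env\<close>-linear map \<open>F\<close>, under the same identification: it sends
  \<open>m \<otimes> w\<close>, which stands for \<open>m \<otimes> (1 \<otimes> 1 \<otimes> w)\<close>, to the elementary tensor of \<open>m\<close> and
  \<open>F (1 \<otimes> 1 \<otimes> w)\<close>.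
\<close>

definition tensor_map ::
  "('g, 'b) monoid_scheme \<Rightarrow> ('g \<Rightarrow> pol \<Rightarrow> pol) \<Rightarrow> (('w \<Rightarrow>\<^sub>0 env) \<Rightarrow> ('u \<Rightarrow>\<^sub>0 env)) \<Rightarrow>
   ('w \<Rightarrow>\<^sub>0 'g skew) \<Rightarrow> ('u \<Rightarrow>\<^sub>0 'g skew)" where
  "tensor_map G A F y =
     (\<Sum>w\<in>Poly_Mapping.keys y.
        env_tensor G A (Poly_Mapping.lookup y w) (F (Poly_Mapping.single w 1)))"


section \<open>The bar and Koszul resolutions\<close>

text \<open>
  The \<open>p\<close>-th term of the bar resolution, the \<open>(p + 2)\<close>-nd tensor power of the symmetric algebra, is
  \<open>env \<otimes> W\<close> with \<open>W\<close> the \<open>p\<close>-th tensor power, whose basis consists of the lists of \<open>p\<close> monomials;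
  the outer two tensor factors are the ones on which \<open>env\<close> acts.  All terms live in one type,
  the degree being the length of the list.
\<close>

definition mon_lists :: "nat \<Rightarrow> nat \<Rightarrow> mon list set" where
  "mon_lists n p = {ms. length ms = p \<and> set ms \<subseteq> mons n}"

text \<open>The tensor of the monomials in a list of length at least two.\<close>

definition bar_mon :: "mon list \<Rightarrow> (mon list \<Rightarrow>\<^sub>0 env)" where
  "bar_mon xs = Poly_Mapping.single (butlast (tl xs)) (Poly_Mapping.single (hd xs, last xs) 1)"

definition merge :: "nat \<Rightarrow> mon list \<Rightarrow> mon list" where
  "merge j xs = take j xs @ (xs ! j + xs ! Suc j) # drop (j + 2) xs"

text \<open>In degree zero the differential is zero: the augmentation is not part of the complex.\<close>

definition bar_diff :: "(mon list \<Rightarrow>\<^sub>0 env) \<Rightarrow> (mon list \<Rightarrow>\<^sub>0 env)" where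
  "bar_diff = env_lin (\<lambda>ms. if ms = [] then 0
     else \<Sum>j\<le>length ms. fscale ((-1) ^ j) (bar_mon (merge j (0 # ms @ [0]))))"

text \<open>
  The exterior power of degree \<open>p\<close> has the basis
  \<open>v i\<^sub>1 \<and> \<dots> \<and> v i\<^sub>p\<close> with \<open>i\<^sub>1 < \<dots> < i\<^sub>p\<close>; this element is represented by the list of its indices.
\<close>

definition incr :: "nat \<Rightarrow> nat \<Rightarrow> nat list set" where
  "incr n p = {I. length I = p \<and> sorted_wrt (<) I \<and> set I \<subseteq> {1..n}}"

definition koszul_diff :: "(nat list \<Rightarrow>\<^sub>0 env) \<Rightarrow> (nat list \<Rightarrow>\<^sub>0 env)" where
  "koszul_diff = env_lin (\<lambda>I. \<Sum>k<length I.
     Poly_Mapping.single (take k I @ drop (Suc k) I)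
       ((-1) ^ k * (Poly_Mapping.single (Poly_Mapping.single (I ! k) 1, 0) 1
                    - Poly_Mapping.single (0, Poly_Mapping.single (I ! k) 1) 1)))"


section \<open>The chain map\<close>

text \<open>
  Lists are indexed from 0, so \<open>ms ! r\<close> has the exponents \<open>\<ell>\<close> with upper index \<open>r + 1\<close>, and
  \<open>I ! r\<close> is the index \<open>i\<close> with lower index \<open>r + 1\<close>.  Let \<open>j\<close> be the number of elements of \<open>I\<close> that
  are less than \<open>i\<close>.  If \<open>i\<close> lies strictly between two consecutive elements of \<open>I\<close>, the exponent of
  \<open>v i\<close> is the sum of the exponents in the first \<open>j\<close> monomials; if \<open>i = I ! j\<close>, then \<open>as ! j\<close> is
  added to that sum.
\<close>

definition Q_exp :: "nat \<Rightarrow> mon list \<Rightarrow> nat list \<Rightarrow> nat list \<Rightarrow> mon" where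
  "Q_exp n ms I as = (\<Sum>i=1..n. Poly_Mapping.single i
     (let j = card {r. r < length I \<and> I ! r < i}
      in (if i \<in> set I then as ! j else 0) + (\<Sum>r<j. Poly_Mapping.lookup (ms ! r) i)))"

definition Q_hat :: "nat \<Rightarrow> mon list \<Rightarrow> nat list \<Rightarrow> nat list \<Rightarrow> mon" where
  "Q_hat n ms I as =
     (THE R. Q_exp n ms I as + R + (\<Sum>i\<leftarrow>I. Poly_Mapping.single i 1) = sum_list ms)"

definition Psi :: "nat \<Rightarrow> (mon list \<Rightarrow>\<^sub>0 env) \<Rightarrow> (nat list \<Rightarrow>\<^sub>0 env)" where
  "Psi n = env_lin (\<lambda>ms. \<Sum>I\<in>incr n (length ms).
     \<Sum>as\<in>{as. length as = length ms \<and> (\<forall>j<length ms. as ! j < Poly_Mapping.lookup (ms ! j) (I ! j))}.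
       Poly_Mapping.single I (Poly_Mapping.single (Q_exp n ms I as, Q_hat n ms I as) 1))"


section \<open>Hochschild homology\<close>

definition bar_chains :: "nat \<Rightarrow> 'g \<Rightarrow> nat \<Rightarrow> (mon list \<Rightarrow>\<^sub>0 'g skew) set" where
  "bar_chains n g p = free_on (mon_lists n p) (Sym_at n g)"

definition koszul_chains :: "nat \<Rightarrow> 'g \<Rightarrow> nat \<Rightarrow> (nat list \<Rightarrow>\<^sub>0 'g skew) set" where
  "koszul_chains n g p = free_on (incr n p) (Sym_at n g)"

definition cscale :: "complex \<Rightarrow> ('w \<Rightarrow>\<^sub>0 'g skew) \<Rightarrow> ('w \<Rightarrow>\<^sub>0 'g skew)" where
  "cscale c y = Poly_Mapping.map (fscale (cst c)) y"

definition is_chain_map ::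
  "(nat \<Rightarrow> ('w \<Rightarrow>\<^sub>0 'g skew) set) \<Rightarrow> (('w \<Rightarrow>\<^sub>0 'g skew) \<Rightarrow> ('w \<Rightarrow>\<^sub>0 'g skew)) \<Rightarrow>
   (nat \<Rightarrow> ('u \<Rightarrow>\<^sub>0 'g skew) set) \<Rightarrow> (('u \<Rightarrow>\<^sub>0 'g skew) \<Rightarrow> ('u \<Rightarrow>\<^sub>0 'g skew)) \<Rightarrow>
   (('w \<Rightarrow>\<^sub>0 'g skew) \<Rightarrow> ('u \<Rightarrow>\<^sub>0 'g skew)) \<Rightarrow> bool" where
  "is_chain_map C d C' d' F \<longleftrightarrow>
     (\<forall>p. \<forall>x\<in>C p. F x \<in> C' p \<and> d' (F x) = F (d x) \<and>
        (\<forall>c. F (cscale c x) = cscale c (F x)) \<and> (\<forall>y\<in>C p. F (x + y) = F x + F y))"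

definition add_grp :: "'m::ab_group_add set \<Rightarrow> 'm monoid" where
  "add_grp Z = \<lparr>carrier = Z, mult = (+), one = 0\<rparr>"

text \<open>Complexes are in degrees \<open>p \<ge> 0\<close>, with a differential \<open>d\<close> that vanishes in degree 0.\<close>

definition cycles :: "(nat \<Rightarrow> 'm::ab_group_add set) \<Rightarrow> ('m \<Rightarrow> 'm) \<Rightarrow> nat \<Rightarrow> 'm set" where
  "cycles C d p = {x \<in> C p. d x = 0}"

definition boundaries :: "(nat \<Rightarrow> 'm::ab_group_add set) \<Rightarrow> ('m \<Rightarrow> 'm) \<Rightarrow> nat \<Rightarrow> 'm set" where
  "boundaries C d p = d ` C (Suc p)"

definition homology :: "(nat \<Rightarrow> 'm::ab_group_add set) \<Rightarrow> ('m \<Rightarrow> 'm) \<Rightarrow> nat \<Rightarrow> 'm set monoid" where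
  "homology C d p = add_grp (cycles C d p) Mod boundaries C d p"

definition induced ::
  "(nat \<Rightarrow> 'm::ab_group_add set) \<Rightarrow> ('m \<Rightarrow> 'm) \<Rightarrow> nat \<Rightarrow> ('l \<Rightarrow> 'm) \<Rightarrow> 'l set \<Rightarrow> 'm set" where
  "induced C' d' p F c = (\<Union>x\<in>c. boundaries C' d' p #>\<^bsub>add_grp (cycles C' d' p)\<^esub> F x)"


section \<open>Elementary tensors and the operators\<close>

text \<open>The tensor of a list of polynomials, expanded in the basis of lists of monomials.\<close>

fun tensor_list :: "pol list \<Rightarrow> (mon list \<Rightarrow>\<^sub>0 complex)" where
  "tensor_list [] = Poly_Mapping.single [] 1"
| "tensor_list (f # fs) =
     (\<Sum>\<alpha>\<in>Poly_Mapping.keys f. \<Sum>ms\<in>Poly_Mapping.keys (tensor_list fs).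
        Poly_Mapping.single (\<alpha> # ms)
          (Poly_Mapping.lookup f \<alpha> * Poly_Mapping.lookup (tensor_list fs) ms))"

definition bar_chain :: "'g skew \<Rightarrow> pol list \<Rightarrow> (mon list \<Rightarrow>\<^sub>0 'g skew)" where
  "bar_chain m fs = (\<Sum>ms\<in>Poly_Mapping.keys (tensor_list fs).
     Poly_Mapping.single ms (fscale (cst (Poly_Mapping.lookup (tensor_list fs) ms)) m))"

definition s_map ::
  "(complex \<Rightarrow> 'v::ab_group_add \<Rightarrow> 'v) \<Rightarrow> nat \<Rightarrow> (nat \<Rightarrow> 'v) \<Rightarrow> (nat \<Rightarrow> complex) \<Rightarrow> nat \<Rightarrow> 'v \<Rightarrow> 'v" where
  "s_map scale n v \<epsilon> i x =
     (\<Sum>j=1..n. scale (coord scale n v x j) (if j = i then scale (\<epsilon> i) (v i) else v j))"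

text \<open>The composite of \<open>s_map\<close> with indices \<open>1, \<dots>, i - 1\<close>.\<close>

definition s_prefix ::
  "(complex \<Rightarrow> 'v::ab_group_add \<Rightarrow> 'v) \<Rightarrow> nat \<Rightarrow> (nat \<Rightarrow> 'v) \<Rightarrow> (nat \<Rightarrow> complex) \<Rightarrow> nat \<Rightarrow> 'v \<Rightarrow> 'v" where
  "s_prefix scale n v \<epsilon> i = foldr (\<lambda>j T. s_map scale n v \<epsilon> j \<circ> T) [1..<i] id"

definition partial :: "nat \<Rightarrow> pol \<Rightarrow> pol" where
  "partial i f = (\<Sum>\<alpha>\<in>Poly_Mapping.keys f.
     Poly_Mapping.single (\<alpha> - Poly_Mapping.single i 1)
       (of_nat (Poly_Mapping.lookup \<alpha> i) * Poly_Mapping.lookup f \<alpha>))"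

text \<open>For \<open>\<epsilon> i \<noteq> 1\<close> the quotient is the exact one; \<open>pol\<close> is an integral domain, so it is unique.\<close>

definition qpartial ::
  "(complex \<Rightarrow> 'v::ab_group_add \<Rightarrow> 'v) \<Rightarrow> nat \<Rightarrow> (nat \<Rightarrow> 'v) \<Rightarrow> (nat \<Rightarrow> complex) \<Rightarrow> nat \<Rightarrow> pol \<Rightarrow> pol" where
  "qpartial scale n v \<epsilon> i f =
     (if \<epsilon> i = 1 then partial i f
      else let s = s_map scale n v \<epsilon> i in
        THE q. q * (incl scale n v (v i) - incl scale n v (s (v i))) = f - sym_ext scale n v s f)"

end

theory Submission
  imports Defs
begin

text \<open>
  The enveloping algebra of \<open>S(V)\<close> is the polynomial ring in the commuting variables
  \<open>x\<^sub>i = v\<^sub>i \<otimes> 1\<close> and \<open>y\<^sub>i = 1 \<otimes> v\<^sub>i\<close>; both resolutions consist of free modules over it.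

  The first idea is that the coefficients of \<open>\<Psi>\<close> are products of divided differences.
  For a monomial \<open>m\<close> put
  \<open>T\<^sub>i(m) = (m(y\<^sub>1,\<dots>,y\<^sub>i\<^sub>-\<^sub>1,x\<^sub>i,\<dots>,x\<^sub>n) - m(y\<^sub>1,\<dots>,y\<^sub>i,x\<^sub>i\<^sub>+\<^sub>1,\<dots>,x\<^sub>n)) / (x\<^sub>i - y\<^sub>i)\<close>.
  The quotient of powers of \<open>x\<^sub>i\<close> and \<open>y\<^sub>i\<close> in it is a geometric sum, whose terms are exactly the
  choices of one exponent \<open>a\<close> in the definition of \<open>\<Psi>\<close>.  So the coefficient of
  \<open>\<Psi>(1 \<otimes> m\<^sub>1 \<otimes> \<dots> \<otimes> m\<^sub>p \<otimes> 1)\<close> at \<open>v\<close> with indices \<open>i\<^sub>1 < \<dots> < i\<^sub>p\<close> is the product of the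
  \<open>T\<close> with index \<open>i\<^sub>k\<close> of \<open>m\<^sub>k\<close> (\<open>sum_exponent_lists\<close>).  On the bimodule \<open>S(V)g\<close> the variable
  \<open>x\<^sub>i\<close> acts as multiplication by \<open>v\<^sub>i\<close> and \<open>y\<^sub>i\<close> as multiplication by \<open>\<epsilon>\<^sub>i v\<^sub>i\<close>, which turns
  \<open>T\<^sub>i(m)\<close> into \<open>\<partial>\<^sub>i m\<close> acted upon by \<open>s\<^sub>1 \<dots> s\<^sub>i\<^sub>-\<^sub>1\<close> (\<open>scale_vars_qdiff\<close>).  As both sides of the
  formula are multilinear, this proves it (\<open>Psi_star_formula\<close>).

  The second idea is that the product formula is a recursion,
  \<open>\<Psi>(m # ms) = \<Sum>\<^sub>i T\<^sub>i(m) \<cdot> (v\<^sub>i \<and> \<Psi>(ms))\<close> with only the terms whose indices increase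
  (\<open>psi_gen_Cons\<close>), and that the bar differential has a recursion of the same kind in terms of its
  contracting homotopy (\<open>bar_gen_Cons\<close>).  An induction along both, with the identity
  \<open>T\<^sub>i(m)(x\<^sub>i - y\<^sub>i) = E\<^sub>i\<^sub>-\<^sub>1(m) - E\<^sub>i(m)\<close> and the twisted Leibniz rule
  \<open>T\<^sub>i(m m') = T\<^sub>i(m) E\<^sub>i(m') + E\<^sub>i\<^sub>-\<^sub>1(m) T\<^sub>i(m')\<close> for
  \<open>E\<^sub>i(m) = m(y\<^sub>1,\<dots>,y\<^sub>i,x\<^sub>i\<^sub>+\<^sub>1,\<dots>,x\<^sub>n)\<close>, shows that \<open>\<Psi>\<close> is a chain map
  (\<open>psi_chain_map_gen\<close>).

  A map \<open>\<Phi>\<close> in the opposite direction is built degree by degree from the contracting homotopy, as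
  in the comparison theorem for resolutions.  Then \<open>\<Psi> \<Phi>\<close> is the identity (\<open>psi_phi_gen\<close>) and
  \<open>\<Phi> \<Psi>\<close> is homotopic to it (\<open>htpy_gen\<close>), by maps that are linear over the enveloping algebra.
  Such identities survive tensoring with \<open>S(V)g\<close> (\<open>tensor_map_comp\<close>), and a homotopy equivalence
  induces isomorphisms in homology (\<open>induced_iso\<close>).
\<close>

abbreviation lookup :: "('a \<Rightarrow>\<^sub>0 'b::zero) \<Rightarrow> 'a \<Rightarrow> 'b" where "lookup \<equiv> Poly_Mapping.lookup"
abbreviation single :: "'a \<Rightarrow> 'b::zero \<Rightarrow> ('a \<Rightarrow>\<^sub>0 'b)" where "single \<equiv> Poly_Mapping.single"
abbreviation keys :: "('a \<Rightarrow>\<^sub>0 'b::zero) \<Rightarrow> 'a set" where "keys \<equiv> Poly_Mapping.keys"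

section \<open>Free modules and additive maps\<close>

lemma lookup_fscale [simp]: "lookup (fscale c x) w = c * lookup x w"
  by (simp add: fscale_def Poly_Mapping.map.rep_eq when_def)

lemma fscale_0_left [simp]: "fscale 0 x = 0"
  and fscale_0_right [simp]: "fscale c 0 = 0"
  by (auto intro: poly_mapping_eqI)

lemma fscale_1 [simp]: "fscale (1 :: 'r::ring_1) x = x"
  by (auto intro: poly_mapping_eqI)

lemma fscale_fscale [simp]: "fscale c (fscale d x) = fscale (c * d :: 'r::ring_1) x"
  by (auto intro: poly_mapping_eqI simp: mult.assoc)

lemma fscale_add_right: "fscale (c :: 'r::ring_1) (x + y) = fscale c x + fscale c y"
  and fscale_diff_right: "fscale c (x - y) = fscale c x - fscale c y"
  and fscale_add_left: "fscale (c + d) x = fscale c x + fscale d x"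
  and fscale_diff_left: "fscale (c - d) x = fscale c x - fscale d x"
  and fscale_minus_left: "fscale (- c) x = - fscale c x"
  by (auto intro!: poly_mapping_eqI simp: lookup_add lookup_minus algebra_simps)

lemma fscale_sum_right: "fscale (c :: 'r::ring_1) (\<Sum>a\<in>S. f a) = (\<Sum>a\<in>S. fscale c (f a))"
  by (auto intro!: poly_mapping_eqI simp: lookup_sum sum_distrib_left)

lemma fscale_single [simp]: "fscale (c :: 'r::ring_1) (single w d) = single w (c * d)"
  by (auto intro!: poly_mapping_eqI simp: lookup_single when_def)

lemma sum_single_lookup: "(\<Sum>w\<in>keys x. single w (lookup x w)) = x"
  by (rule poly_mapping_eqI)
    (auto simp: lookup_sum lookup_single when_def in_keys_iff sum.delta cong: if_cong)

lemma sum_keys_superset: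
  assumes "finite S" "keys x \<subseteq> S" "\<And>w. \<phi> w 0 = 0"
  shows "(\<Sum>w\<in>keys x. \<phi> w (lookup x w)) = (\<Sum>w\<in>S. \<phi> w (lookup x w))"
  using assms by (intro sum.mono_neutral_left) (auto simp: in_keys_iff)

lemma sum_keys_single:
  assumes "\<And>w. \<phi> w 0 = 0"
  shows "(\<Sum>w\<in>keys (single u c). \<phi> w (lookup (single u c) w)) = \<phi> u c"
  using assms by (subst sum_keys_superset[of "{u}"]) auto

lemma additive_sum_keys:
  assumes "\<And>w. additive (\<phi> w)"
  shows "additive (\<lambda>x. \<Sum>w\<in>keys x. \<phi> w (lookup x w))"
  using assms by unfold_locales
    (rule setsum_keys_plus_distrib, auto simp: additive.add additive.zero)

text \<open>
  The maps below are all additive, but the contracting homotopy of the bar resolution is not linear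
  over the enveloping algebra.  So the common way to prove two of them equal is to compare them on
  the summands of an element, here on the components of a free module, and in the next lemma on
  scalar multiples of the elements of the vector space basis.
\<close>

lemma additive_ext:
  assumes "additive F" "additive H" "\<And>w. w \<in> keys x \<Longrightarrow> F (single w (lookup x w)) = H (single w (lookup x w))"
  shows "F x = H x"
proof -
  have "F (\<Sum>w\<in>keys x. single w (lookup x w)) = H (\<Sum>w\<in>keys x. single w (lookup x w))"
    using assms by (simp add: additive.sum)
  then show ?thesis by (simp add: sum_single_lookup)
qed

lemma additive_ext2:
  fixes F H :: "('w \<Rightarrow>\<^sub>0 ('k \<Rightarrow>\<^sub>0 'r::ab_group_add)) \<Rightarrow> 'm::ab_group_add"
  assumes F: "additive F" and H: "additive H"
    and eq: "\<And>w p c. w \<in> keys x \<Longrightarrow> p \<in> keys (lookup x w) \<Longrightarrow> F (single w (single p c)) = H (single w (single p c))"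
  shows "F x = H x"
proof (rule additive_ext[OF F H])
  fix w assume w: "w \<in> keys x"
  show "F (single w (lookup x w)) = H (single w (lookup x w))"
    by (rule additive_ext[where F = "\<lambda>c. F (single w c)" and H = "\<lambda>c. H (single w c)"])
      (unfold_locales, auto simp: single_add additive.add[OF F] additive.add[OF H] eq w)
qed

lemma additive_comp: "additive F \<Longrightarrow> additive H \<Longrightarrow> additive (\<lambda>x. F (H x))"
  by (simp add: additive_def)

lemma additive_fscale: "additive (fscale (c :: 'r::ring_1))"
  by unfold_locales (rule fscale_add_right)

lemma additive_env_lin: "additive (env_lin \<phi>)"
  unfolding env_lin_def[abs_def]
  by (rule additive_sum_keys) (unfold_locales, simp add: fscale_add_left)

lemmas env_lin_add = additive.add[OF additive_env_lin]
  and env_lin_0 = additive.zero[OF additive_env_lin]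
  and env_lin_diff = additive.diff[OF additive_env_lin]
  and env_lin_sum = additive.sum[OF additive_env_lin]

lemma env_lin_superset:
  "finite S \<Longrightarrow> keys x \<subseteq> S \<Longrightarrow> env_lin \<phi> x = (\<Sum>w\<in>S. fscale (lookup x w) (\<phi> w))"
  unfolding env_lin_def by (rule sum_keys_superset) auto

lemma env_lin_single [simp]: "env_lin \<phi> (single w c) = fscale c (\<phi> w)"
  unfolding env_lin_def by (subst sum_keys_single) auto

lemma env_lin_fscale [simp]: "env_lin \<phi> (fscale c x) = fscale c (env_lin \<phi> x)"
  by (subst (1 2) env_lin_superset[of "keys x"]) (auto simp: fscale_sum_right in_keys_iff)

lemma env_lin_comp: "env_lin \<phi> (env_lin \<psi> x) = env_lin (\<lambda>w. env_lin \<phi> (\<psi> w)) x"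
  unfolding env_lin_def[of \<psi>] env_lin_def[of "\<lambda>w. env_lin \<phi> (\<psi> w)"] by (simp add: env_lin_sum)

lemma env_lin_cong: "(\<And>w. w \<in> keys x \<Longrightarrow> \<phi> w = \<psi> w) \<Longrightarrow> env_lin \<phi> x = env_lin \<psi> x"
  unfolding env_lin_def by (rule sum.cong) auto

lemma env_lin_basis: "env_lin (\<lambda>w. single w 1) x = x"
  unfolding env_lin_def by (simp add: sum_single_lookup)

section \<open>Divided differences of monomials\<close>

text \<open>
  The value of the monomial \<open>\<alpha>\<close> at \<open>(y\<^sub>1,\<dots>,y\<^sub>i,x\<^sub>i\<^sub>+\<^sub>1,\<dots>,x\<^sub>n)\<close>.
\<close>

definition mixed_mon :: "(nat \<Rightarrow> 'r::comm_ring_1) \<Rightarrow> (nat \<Rightarrow> 'r) \<Rightarrow> nat \<Rightarrow> nat \<Rightarrow> mon \<Rightarrow> 'r" where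
  "mixed_mon x y n i \<alpha> =
     (\<Prod>l\<in>{1..i}. y l ^ lookup \<alpha> l) * (\<Prod>l\<in>{i<..n}. x l ^ lookup \<alpha> l)"

text \<open>
  The divided difference of two consecutive mixed values, with the division by \<open>x\<^sub>i - y\<^sub>i\<close> carried
  out.  The ring and the points are arbitrary because three instances occur: the variables of the
  enveloping algebra, their images under the twisted action, and the points whose quotient is
  \<open>\<partial>\<^sub>i\<close>.
\<close>

definition divdiff_mon :: "(nat \<Rightarrow> 'r::comm_ring_1) \<Rightarrow> (nat \<Rightarrow> 'r) \<Rightarrow> nat \<Rightarrow> nat \<Rightarrow> mon \<Rightarrow> 'r" where
  "divdiff_mon x y n i \<alpha> =
     (\<Prod>l\<in>{1..<i}. y l ^ lookup \<alpha> l) *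
     (\<Sum>a<lookup \<alpha> i. x i ^ a * y i ^ (lookup \<alpha> i - 1 - a)) *
     (\<Prod>l\<in>{i<..n}. x l ^ lookup \<alpha> l)"

lemma geometric_sum_Suc:
  fixes x y :: "'r::comm_ring_1"
  shows "(\<Sum>a<Suc p. x ^ a * y ^ (Suc p - 1 - a)) = x ^ p + y * (\<Sum>a<p. x ^ a * y ^ (p - 1 - a))"
proof -
  have "(\<Sum>a<p. x ^ a * y ^ (p - a)) = y * (\<Sum>a<p. x ^ a * y ^ (p - 1 - a))"
    unfolding sum_distrib_left
  proof (rule sum.cong)
    fix a assume "a \<in> {..<p}"
    then have "p - a = Suc (p - 1 - a)" by auto
    then show "x ^ a * y ^ (p - a) = y * (x ^ a * y ^ (p - 1 - a))" by simp
  qed simp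
  then show ?thesis by simp
qed

lemma geometric_sum_mult_diff:
  fixes x y :: "'r::comm_ring_1"
  shows "(\<Sum>a<p. x ^ a * y ^ (p - 1 - a)) * (x - y) = x ^ p - y ^ p"
proof (induction p)
  case (Suc p)
  show ?case
    unfolding geometric_sum_Suc distrib_right mult.assoc Suc by (simp add: algebra_simps)
qed simp

lemma geometric_sum_add:
  fixes x y :: "'r::comm_ring_1"
  shows "(\<Sum>a<p + q. x ^ a * y ^ (p + q - 1 - a)) =
    (\<Sum>a<p. x ^ a * y ^ (p - 1 - a)) * y ^ q + x ^ p * (\<Sum>a<q. x ^ a * y ^ (q - 1 - a))"
proof (induction q)
  case (Suc q)
  show ?case
    unfolding add_Suc_right geometric_sum_Suc Suc by (simp add: algebra_simps power_add)
qed simp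

lemma mixed_mon_pred:
  assumes "i \<in> {1..n}"
  shows "mixed_mon x y n (i - 1) \<alpha> =
    (\<Prod>l\<in>{1..<i}. y l ^ lookup \<alpha> l) * x i ^ lookup \<alpha> i * (\<Prod>l\<in>{i<..n}. x l ^ lookup \<alpha> l)"
proof -
  have "{i - 1<..n} = insert i {i<..n}" "{1..i - 1} = {1..<i}" using assms by auto
  then show ?thesis by (simp add: mixed_mon_def mult.assoc)
qed

lemma mixed_mon_self:
  assumes "i \<in> {1..n}"
  shows "mixed_mon x y n i \<alpha> =
    (\<Prod>l\<in>{1..<i}. y l ^ lookup \<alpha> l) * y i ^ lookup \<alpha> i * (\<Prod>l\<in>{i<..n}. x l ^ lookup \<alpha> l)"
proof -
  have "{1..i} = insert i {1..<i}" using assms by auto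
  then show ?thesis by (simp add: mixed_mon_def ac_simps)
qed

lemma divdiff_mon_mult:
  assumes "i \<in> {1..n}"
  shows "divdiff_mon x y n i \<alpha> * (x i - y i) = mixed_mon x y n (i - 1) \<alpha> - mixed_mon x y n i \<alpha>"
proof -
  have "divdiff_mon x y n i \<alpha> * (x i - y i) =
    (\<Prod>l\<in>{1..<i}. y l ^ lookup \<alpha> l) *
     ((\<Sum>a<lookup \<alpha> i. x i ^ a * y i ^ (lookup \<alpha> i - 1 - a)) * (x i - y i)) *
     (\<Prod>l\<in>{i<..n}. x l ^ lookup \<alpha> l)"
    by (simp add: divdiff_mon_def ac_simps)
  then show ?thesis
    unfolding geometric_sum_mult_diff mixed_mon_pred[OF assms] mixed_mon_self[OF assms]
    by (simp add: algebra_simps)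
qed

text \<open>
  Consecutive mixed values cancel.  For \<open>k = n\<close> this writes \<open>m \<otimes> 1 - 1 \<otimes> m\<close> as a combination of
  the \<open>x\<^sub>i - y\<^sub>i\<close>, which is the chain map property in the lowest degree.
\<close>

lemma divdiff_mon_telescope:
  assumes "k \<le> n"
  shows "(\<Sum>i=1..k. divdiff_mon x y n i \<alpha> * (x i - y i)) = mixed_mon x y n 0 \<alpha> - mixed_mon x y n k \<alpha>"
  using assms
proof (induction k)
  case (Suc k)
  then show ?case by (simp add: divdiff_mon_mult)
qed simp

text \<open>
  The twisted Leibniz rule: split the difference of the values of a product at two consecutive
  mixed points by changing the point first in one factor and then in the other.
\<close>

lemma divdiff_mon_add:
  assumes "i \<in> {1..n}"
  shows "divdiff_mon x y n i (\<alpha> + \<beta>) =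
    divdiff_mon x y n i \<alpha> * mixed_mon x y n i \<beta> + mixed_mon x y n (i - 1) \<alpha> * divdiff_mon x y n i \<beta>"
  unfolding mixed_mon_pred[OF assms] mixed_mon_self[OF assms] divdiff_mon_def
    lookup_add geometric_sum_add power_add prod.distrib
  by (simp add: algebra_simps)

lemma divdiff_mon_single:
  assumes "i \<in> {1..n}" "k \<in> {1..n}"
  shows "divdiff_mon x y n i (single k 1) = (if i = k then 1 else 0)"
proof -
  have "(\<Prod>l\<in>S. z l ^ lookup (single k (1::nat)) l) = 1" if "k \<notin> S" for S and z :: "nat \<Rightarrow> 'a"
    using that by (intro prod.neutral) (auto simp: lookup_single when_def)
  then show ?thesis by (auto simp: divdiff_mon_def lookup_single when_def)
qed

section \<open>The chain map in terms of divided differences\<close>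

definition xvar :: "nat \<Rightarrow> env" where "xvar l = single (single l 1, 0) 1"
definition yvar :: "nat \<Rightarrow> env" where "yvar l = single (0, single l 1) 1"

lemma prod_single: "finite S \<Longrightarrow> (\<Prod>l\<in>S. single (f l) 1) = single (\<Sum>l\<in>S. f l) (1 :: 'r::comm_semiring_1)"
  by (induction S rule: finite_induct) (auto simp: mult_single)

lemma xvar_power: "xvar l ^ m = single (single l m, 0) 1"
  and yvar_power: "yvar l ^ m = single (0, single l m) 1"
  by (induction m) (auto simp: xvar_def yvar_def mult_single single_add[symmetric] zero_prod_def[symmetric])

lemma prod_xvar: "finite S \<Longrightarrow> (\<Prod>l\<in>S. xvar l ^ m l) = single (\<Sum>l\<in>S. single l (m l), 0) 1"
  and prod_yvar: "finite S \<Longrightarrow> (\<Prod>l\<in>S. yvar l ^ m l) = single (0, \<Sum>l\<in>S. single l (m l)) 1"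
  by (simp_all add: xvar_power yvar_power prod_single sum_prod)

lemma mons_expand: "m \<in> mons n \<Longrightarrow> (\<Sum>l\<in>{1..n}. single l (lookup m l)) = m"
  using sum_keys_superset[of "{1..n}" m single] by (simp add: mons_def sum_single_lookup)

text \<open>
  The two extreme mixed values are the left and the right multiplication by a monomial.
\<close>

lemma mixed_mon_first: "m \<in> mons n \<Longrightarrow> mixed_mon xvar yvar n 0 m = single (m, 0) 1"
  and mixed_mon_last: "m \<in> mons n \<Longrightarrow> mixed_mon xvar yvar n n m = single (0, m) 1"
proof -
  have "{0<..n} = {1..n}" by auto
  then show "m \<in> mons n \<Longrightarrow> mixed_mon xvar yvar n 0 m = single (m, 0) 1"
    by (simp add: mixed_mon_def prod_xvar mons_expand del: One_nat_def)
qed (simp add: mixed_mon_def prod_yvar mons_expand del: One_nat_def)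

abbreviation divdiff :: "nat \<Rightarrow> nat \<Rightarrow> mon \<Rightarrow> env" where
  "divdiff \<equiv> divdiff_mon xvar yvar"

lemma incr_Cons: "i # J \<in> incr n (Suc p) \<longleftrightarrow> i \<in> {1..n} \<and> J \<in> incr n p \<and> (\<forall>j\<in>set J. i < j)"
  by (auto simp: incr_def)

lemma incr_0 [simp]: "incr n 0 = {[]}"
  by (auto simp: incr_def)

lemma finite_incr [simp]: "finite (incr n p)"
  by (rule finite_subset[OF _ finite_lists_length_eq[of "{1..n}" p]]) (auto simp: incr_def)

lemma incr_length: "I \<in> incr n p \<Longrightarrow> length I = p"
  by (simp add: incr_def)

lemma mon_lists_Cons: "m # ms \<in> mon_lists n (Suc p) \<longleftrightarrow> m \<in> mons n \<and> ms \<in> mon_lists n p"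
  by (auto simp: mon_lists_def)

lemma mon_lists_0 [simp]: "mon_lists n 0 = {[]}"
  by (auto simp: mon_lists_def)

lemma lookup_Q_exp:
  "lookup (Q_exp n ms I as) l =
    (if l \<in> {1..n} then
       (if l \<in> set I then as ! length (filter (\<lambda>i. i < l) I) else 0)
         + (\<Sum>r<length (filter (\<lambda>i. i < l) I). lookup (ms ! r) l)
     else 0)"
  by (auto simp: Q_exp_def lookup_sum lookup_single when_def length_filter_conv_card Let_def
        sum.delta cong: if_cong)

text \<open>
  Peeling off the first monomial \<open>m\<close> and the first index \<open>i\<close>.  All later indices exceed \<open>i\<close>, so an
  exponent at \<open>l < i\<close> is zero, at \<open>l = i\<close> it is the chosen \<open>a\<close>, and at \<open>l > i\<close> the sum of exponents
  starts with that of \<open>m\<close>.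
\<close>

lemma Q_exp_Cons:
  assumes "i # J \<in> incr n (Suc p)"
  shows "Q_exp n (m # ms) (i # J) (a # as) =
    single i a + (\<Sum>l\<in>{i<..n}. single l (lookup m l)) + Q_exp n ms J as"
proof (rule poly_mapping_eqI)
  fix l
  have i: "i \<in> {1..n}" and J: "\<forall>j\<in>set J. i < j" using assms by (auto simp: incr_Cons)
  have sum: "lookup (\<Sum>l\<in>{i<..n}. single l (lookup m l)) l = (if l \<in> {i<..n} then lookup m l else 0)"
    by (auto simp: lookup_sum lookup_single when_def sum.delta cong: if_cong)
  show "lookup (Q_exp n (m # ms) (i # J) (a # as)) l =
    lookup (single i a + (\<Sum>l\<in>{i<..n}. single l (lookup m l)) + Q_exp n ms J as) l"
  proof (cases "i < l")
    case True
    then show ?thesis using i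
      unfolding lookup_add sum lookup_Q_exp
      by (auto simp: lookup_single when_def sum.lessThan_Suc_shift simp del: sum.lessThan_Suc)
  next
    case False
    then have "filter (\<lambda>i. i < l) J = []" "l \<notin> set J" using J by (auto simp: filter_empty_conv)
    then show ?thesis using i False
      unfolding lookup_add sum lookup_Q_exp by (auto simp: lookup_single when_def)
  qed
qed

lemma Q_hat_eqI:
  "Q_exp n ms I as + R + (\<Sum>i\<leftarrow>I. single i 1) = sum_list ms \<Longrightarrow> Q_hat n ms I as = R"
  unfolding Q_hat_def
proof (rule the_equality)
  fix R' assume "Q_exp n ms I as + R + (\<Sum>i\<leftarrow>I. single i 1) = sum_list ms"
    "Q_exp n ms I as + R' + (\<Sum>i\<leftarrow>I. single i 1) = sum_list ms"
  then have "Q_exp n ms I as + R' + (\<Sum>i\<leftarrow>I. single i 1) = Q_exp n ms I as + R + (\<Sum>i\<leftarrow>I. single i 1)"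
    by simp
  then show "R' = R" unfolding add_right_cancel add_left_cancel .
qed

text \<open>
  The complementary exponent has the same recursion: what \<open>m\<close> contributes to it is all of \<open>m\<close> below
  \<open>i\<close> and, at \<open>i\<close>, what remains after taking away \<open>a\<close> and the factor \<open>v\<^sub>i\<close> of the exterior power.
\<close>

lemma Q_hat_Cons_aux:
  assumes IJ: "i # J \<in> incr n (Suc p)" and m: "m \<in> mons n" and a: "a < lookup m i"
    and eq: "Q_exp n ms J as + Q_hat n ms J as + (\<Sum>i\<leftarrow>J. single i 1) = sum_list ms"
  shows "Q_exp n (m # ms) (i # J) (a # as)
    + ((\<Sum>l\<in>{1..<i}. single l (lookup m l)) + single i (lookup m i - 1 - a) + Q_hat n ms J as)
    + (\<Sum>i\<leftarrow>i # J. single i 1) = sum_list (m # ms)"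
proof -
  have i: "i \<in> {1..n}" using IJ by (simp add: incr_Cons)
  have "single i a + single i (lookup m i - 1 - a) + single i 1 = single i (lookup m i)"
    using a by (simp flip: single_add)
  moreover have "{1..n} = {1..<i} \<union> insert i {i<..n}" using i by auto
  then have "(\<Sum>l\<in>{1..n}. single l (lookup m l)) =
      (\<Sum>l\<in>{1..<i}. single l (lookup m l)) + (\<Sum>l\<in>insert i {i<..n}. single l (lookup m l))"
    by (simp only:) (rule sum.union_disjoint, auto)
  then have "m = (\<Sum>l\<in>{1..<i}. single l (lookup m l)) + (single i (lookup m i) + (\<Sum>l\<in>{i<..n}. single l (lookup m l)))"
    by (simp add: mons_expand[OF m] del: One_nat_def)
  ultimately have "(\<Sum>l\<in>{1..<i}. single l (lookup m l)) + (single i a + single i (lookup m i - 1 - a) + single i 1)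
    + (\<Sum>l\<in>{i<..n}. single l (lookup m l)) + sum_list ms = m + sum_list ms"
    by (simp add: ac_simps)
  then show ?thesis
    unfolding Q_exp_Cons[OF IJ] sum_list.Cons eq[symmetric] list.map by (simp add: ac_simps)
qed

definition exponent_lists :: "mon list \<Rightarrow> nat list \<Rightarrow> nat list set" where
  "exponent_lists ms I = {as. length as = length ms \<and> (\<forall>j<length ms. as ! j < lookup (ms ! j) (I ! j))}"

lemma exponent_lists_Nil: "exponent_lists [] I = {[]}"
  by (auto simp: exponent_lists_def)

lemma exponent_lists_Cons:
  "exponent_lists (m # ms) (i # J) = (\<lambda>(a, as). a # as) ` ({..<lookup m i} \<times> exponent_lists ms J)"
proof (intro equalityI subsetI)
  fix as assume as: "as \<in> exponent_lists (m # ms) (i # J)"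
  then obtain b bs where b: "as = b # bs" by (cases as) (auto simp: exponent_lists_def)
  have "b < lookup m i" using as by (auto simp: b exponent_lists_def dest: spec[of _ 0])
  moreover have "bs ! j < lookup (ms ! j) (J ! j)" if "j < length ms" for j
    using as that by (auto simp: b exponent_lists_def dest: spec[of _ "Suc j"])
  ultimately show "as \<in> (\<lambda>(a, as). a # as) ` ({..<lookup m i} \<times> exponent_lists ms J)"
    using as by (auto simp: b exponent_lists_def)
qed (auto simp: exponent_lists_def nth_Cons split: nat.split)

text \<open>
  The definite description of the complementary exponent is meaningful because such an exponent
  exists; uniqueness is cancellation.
\<close>

lemma Q_complement:
  assumes "ms \<in> mon_lists n p" "I \<in> incr n p" "as \<in> exponent_lists ms I"
  shows "Q_exp n ms I as + Q_hat n ms I as + (\<Sum>i\<leftarrow>I. single i 1) = sum_list ms"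
  using assms
proof (induction p arbitrary: ms I as)
  case 0
  have "Q_exp n [] [] [] + 0 + (\<Sum>i\<leftarrow>[]. single i 1) = sum_list ([] :: mon list)"
    by (rule poly_mapping_eqI) (simp add: lookup_Q_exp)
  with Q_hat_eqI[OF this] show ?case using 0 by (simp add: exponent_lists_Nil)
next
  case (Suc p)
  obtain m ms' where ms: "ms = m # ms'" using Suc.prems by (cases ms) (auto simp: mon_lists_def)
  obtain i J where I: "I = i # J" using Suc.prems by (cases I) (auto simp: incr_def)
  obtain a as' where as: "as = a # as'" "a < lookup m i" "as' \<in> exponent_lists ms' J"
    using Suc.prems by (auto simp: ms I exponent_lists_Cons)
  have IJ: "i # J \<in> incr n (Suc p)" and m: "m \<in> mons n" using Suc.prems by (auto simp: ms I mon_lists_Cons)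
  have "Q_exp n ms' J as' + Q_hat n ms' J as' + (\<Sum>i\<leftarrow>J. single i 1) = sum_list ms'"
    using Suc.prems as by (intro Suc.IH) (auto simp: ms I mon_lists_Cons incr_Cons)
  note aux = Q_hat_Cons_aux[OF IJ m as(2) this]
  show ?case unfolding ms I as Q_hat_eqI[OF aux] by (rule aux)
qed

lemma Q_hat_Cons:
  assumes "i # J \<in> incr n (Suc p)" "m \<in> mons n" "a < lookup m i"
    "ms \<in> mon_lists n p" "as \<in> exponent_lists ms J"
  shows "Q_hat n (m # ms) (i # J) (a # as) =
    (\<Sum>l\<in>{1..<i}. single l (lookup m l)) + single i (lookup m i - 1 - a) + Q_hat n ms J as"
  using assms by (intro Q_hat_eqI Q_hat_Cons_aux Q_complement) (auto simp: incr_Cons)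

text \<open>
  The sum over all choices of exponents factors, since the exponent chosen at \<open>i\<^sub>k\<close> affects only the
  contribution of the \<open>k\<close>-th monomial; each factor is the geometric sum of a divided difference.
\<close>

lemma sum_exponent_lists:
  assumes "ms \<in> mon_lists n p" "I \<in> incr n p"
  shows "(\<Sum>as\<in>exponent_lists ms I. single (Q_exp n ms I as, Q_hat n ms I as) 1) =
    prod_list (map2 (divdiff n) I ms)"
  using assms
proof (induction p arbitrary: ms I)
  case 0
  have "Q_exp n [] [] [] = 0"
    by (rule poly_mapping_eqI) (simp add: lookup_Q_exp)
  moreover have "Q_hat n [] [] [] = 0"
    by (rule Q_hat_eqI) (simp add: calculation)
  ultimately show ?case using 0 by (simp add: exponent_lists_Nil zero_prod_def[symmetric])
next
  case (Suc p)
  obtain m ms' where ms: "ms = m # ms'" using Suc.prems by (cases ms) (auto simp: mon_lists_def)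
  obtain i J where I: "I = i # J" using Suc.prems by (cases I) (auto simp: incr_def)
  have IJ: "i # J \<in> incr n (Suc p)" and m: "m \<in> mons n" and ms': "ms' \<in> mon_lists n p"
    and J: "J \<in> incr n p" and i: "i \<in> {1..n}"
    using Suc.prems by (auto simp: ms I mon_lists_Cons incr_Cons)
  define t where "t a = (single (single i a + (\<Sum>l\<in>{i<..n}. single l (lookup m l)),
     (\<Sum>l\<in>{1..<i}. single l (lookup m l)) + single i (lookup m i - 1 - a)) 1 :: env)" for a
  have t: "t a = (\<Prod>l\<in>{1..<i}. yvar l ^ lookup m l) * (xvar i ^ a * yvar i ^ (lookup m i - 1 - a)) *
     (\<Prod>l\<in>{i<..n}. xvar l ^ lookup m l)" for a
    unfolding prod_xvar[OF finite_greaterThanAtMost] prod_yvar[OF finite_atLeastLessThan]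
    by (simp add: t_def mult_single xvar_power yvar_power)
  have T: "(\<Sum>a<lookup m i. t a) = divdiff n i m"
    unfolding t divdiff_mon_def sum_distrib_left sum_distrib_right ..
  have "(\<Sum>as\<in>exponent_lists ms I. single (Q_exp n ms I as, Q_hat n ms I as) 1) =
    (\<Sum>(a, as)\<in>{..<lookup m i} \<times> exponent_lists ms' J.
       single (Q_exp n (m # ms') (i # J) (a # as), Q_hat n (m # ms') (i # J) (a # as)) 1 :: env)"
    unfolding ms I exponent_lists_Cons
    by (subst sum.reindex) (auto simp: inj_on_def case_prod_unfold)
  also have "\<dots> = (\<Sum>(a, as)\<in>{..<lookup m i} \<times> exponent_lists ms' J.
       t a * single (Q_exp n ms' J as, Q_hat n ms' J as) 1)"
  proof (rule sum.cong, simp, clarsimp)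
    fix a as assume "a < lookup m i" "as \<in> exponent_lists ms' J"
    then show "single (Q_exp n (m # ms') (i # J) (a # as), Q_hat n (m # ms') (i # J) (a # as)) 1 =
      t a * single (Q_exp n ms' J as, Q_hat n ms' J as) 1"
      by (simp add: Q_exp_Cons[OF IJ] Q_hat_Cons[OF IJ m _ ms'] t_def mult_single)
  qed
  also have "\<dots> = (\<Sum>a<lookup m i. t a) *
      (\<Sum>as\<in>exponent_lists ms' J. single (Q_exp n ms' J as, Q_hat n ms' J as) 1)"
    by (simp add: sum_product sum.cartesian_product)
  also have "\<dots> = divdiff n i m * prod_list (map2 (divdiff n) J ms')"
    unfolding T Suc.IH[OF ms' J] ..
  finally show ?case by (simp add: ms I)
qed

definition psi_gen :: "nat \<Rightarrow> mon list \<Rightarrow> (nat list \<Rightarrow>\<^sub>0 env)" where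
  "psi_gen n ms = (\<Sum>I\<in>incr n (length ms). single I (prod_list (map2 (divdiff n) I ms)))"

lemma sum_single_fixed: "(\<Sum>a\<in>S. single I (c a)) = single I (\<Sum>a\<in>S. c a)"
  by (rule poly_mapping_eqI) (auto simp: lookup_sum lookup_single when_def)

lemma Psi_single:
  assumes "ms \<in> mon_lists n p"
  shows "Psi n (single ms c) = fscale c (psi_gen n ms)"
proof -
  have "length ms = p" using assms by (simp add: mon_lists_def)
  then show ?thesis
    unfolding Psi_def env_lin_single psi_gen_def exponent_lists_def[symmetric] sum_single_fixed
    by (intro arg_cong[where f = "fscale c"] sum.cong arg_cong2[where f = single]
        sum_exponent_lists[OF assms]) auto
qed

text \<open>
  Left exterior multiplication by \<open>v\<^sub>i\<close>, truncated to the basis elements for which the resulting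
  list of indices is again increasing.
\<close>

definition prepend :: "nat \<Rightarrow> (nat list \<Rightarrow>\<^sub>0 env) \<Rightarrow> (nat list \<Rightarrow>\<^sub>0 env)" where
  "prepend i = env_lin (\<lambda>J. if \<forall>j\<in>set J. i < j then single (i # J) 1 else 0)"

lemma psi_gen_Nil [simp]: "psi_gen n [] = single [] 1"
  by (simp add: psi_gen_def)

text \<open>
  The product formula for the coefficients, read as a recursion in the first monomial.  The
  homological arguments about \<open>\<Psi>\<close> use this recursion in place of the explicit formula.
\<close>

lemma psi_gen_Cons:
  "psi_gen n (m # ms) = (\<Sum>i=1..n. fscale (divdiff n i m) (prepend i (psi_gen n ms)))"
proof -
  define p where "p = length ms"
  let ?S = "\<lambda>i. {J \<in> incr n p. \<forall>j\<in>set J. i < j}"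
  have incr: "incr n (Suc p) = (\<lambda>(i, J). i # J) ` (SIGMA i:{1..n}. ?S i)"
  proof (intro equalityI subsetI)
    fix I assume I: "I \<in> incr n (Suc p)"
    then obtain i J where "I = i # J" by (cases I) (auto simp: incr_def)
    with I show "I \<in> (\<lambda>(i, J). i # J) ` (SIGMA i:{1..n}. ?S i)"
      by (auto simp: incr_Cons)
  qed (auto simp: incr_Cons)
  have "psi_gen n (m # ms) = (\<Sum>i\<in>{1..n}. \<Sum>J\<in>?S i. single (i # J) (divdiff n i m * prod_list (map2 (divdiff n) J ms)))"
    unfolding psi_gen_def p_def[symmetric] list.size add_Suc_right add_0_right incr
    by (subst sum.reindex) (auto simp: inj_on_def sum.Sigma case_prod_unfold)
  also have "\<dots> = (\<Sum>i=1..n. fscale (divdiff n i m) (prepend i (psi_gen n ms)))"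
  proof (rule sum.cong[OF refl])
    fix i
    have "fscale (divdiff n i m) (prepend i (psi_gen n ms)) =
       (\<Sum>J\<in>incr n p. if \<forall>j\<in>set J. i < j then single (i # J) (divdiff n i m * prod_list (map2 (divdiff n) J ms)) else 0)"
      by (simp add: prepend_def psi_gen_def p_def env_lin_sum fscale_sum_right if_distrib cong: if_cong)
    then show "(\<Sum>J\<in>?S i. single (i # J) (divdiff n i m * prod_list (map2 (divdiff n) J ms))) =
      fscale (divdiff n i m) (prepend i (psi_gen n ms))"
      by (simp add: sum.inter_filter)
  qed
  finally show ?thesis .
qed

section \<open>The contracting homotopy of the bar resolution\<close>

definition bar_gen :: "mon list \<Rightarrow> (mon list \<Rightarrow>\<^sub>0 env)" where
  "bar_gen ms = (if ms = [] then 0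
     else \<Sum>j\<le>length ms. fscale ((-1) ^ j) (bar_mon (merge j (0 # ms @ [0]))))"

lemma bar_diff_eq: "bar_diff = env_lin bar_gen"
  by (simp add: bar_diff_def bar_gen_def[abs_def])

lemma bar_diff_single [simp]: "bar_diff (single ms c) = fscale c (bar_gen ms)"
  by (simp add: bar_diff_eq)

lemma bar_gen_Nil [simp]: "bar_gen [] = 0"
  by (simp add: bar_gen_def)

text \<open>
  The contracting homotopy \<open>a\<^sub>0 \<otimes> a\<^sub>1 \<otimes> \<dots> \<mapsto> 1 \<otimes> a\<^sub>0 \<otimes> a\<^sub>1 \<otimes> \<dots>\<close>.  It is linear only over the
  right tensor factor.
\<close>

definition contr :: "(mon list \<Rightarrow>\<^sub>0 env) \<Rightarrow> (mon list \<Rightarrow>\<^sub>0 env)" where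
  "contr X = (\<Sum>ms\<in>keys X. \<Sum>p\<in>keys (lookup X ms).
     single (fst p # ms) (single (0, snd p) (lookup (lookup X ms) p)))"

text \<open>
  In degree zero, where the complex is not exact, the map \<open>a \<otimes> b \<mapsto> 1 \<otimes> a b\<close>: the augmentation
  followed by its section.
\<close>

definition aug :: "(mon list \<Rightarrow>\<^sub>0 env) \<Rightarrow> (mon list \<Rightarrow>\<^sub>0 env)" where
  "aug X = single [] (\<Sum>p\<in>keys (lookup X []). single (0, fst p + snd p) (lookup (lookup X []) p))"

lemma additive_contr: "additive contr"
  unfolding contr_def[abs_def]
proof (rule additive_sum_keys)
  fix ms :: "mon list"
  show "additive (\<lambda>e. \<Sum>p\<in>keys e. single (fst p # ms) (single (0, snd p) (lookup e p)))"
    by (rule additive_sum_keys) (unfold_locales, simp add: single_add)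
qed

lemma additive_aug: "additive aug"
proof -
  have "additive (\<lambda>e :: env. \<Sum>p\<in>keys e. single (0 :: mon, fst p + snd p) (lookup e p))"
    by (rule additive_sum_keys) (unfold_locales, simp add: single_add)
  then show ?thesis
    unfolding aug_def[abs_def] by (simp add: additive_def lookup_add single_add)
qed

lemma contr_single [simp]:
  "contr (single ms (single (\<alpha>, \<beta>) c)) = single (\<alpha> # ms) (single (0, \<beta>) c)"
  unfolding contr_def by (subst sum_keys_single, simp, subst sum_keys_single) auto

lemma aug_single [simp]:
  "aug (single ms (single (\<alpha>, \<beta>) c)) = (if ms = [] then single [] (single (0, \<alpha> + \<beta>) c) else 0)"
  unfolding aug_def by (auto simp: sum_keys_single lookup_single when_def)

lemmas contr_add = additive.add[OF additive_contr]
  and contr_diff = additive.diff[OF additive_contr]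
  and contr_0 = additive.zero[OF additive_contr]
  and contr_minus = additive.minus[OF additive_contr]
  and contr_sum = additive.sum[OF additive_contr]
  and aug_diff = additive.diff[OF additive_aug]
  and aug_0 = additive.zero[OF additive_aug]

lemma aug_eq_0: "lookup X [] = 0 \<Longrightarrow> aug X = 0"
  by (simp add: aug_def)

lemma lookup_contr_Nil [simp]: "lookup (contr X) [] = 0"
  by (simp add: contr_def lookup_sum lookup_single)

lemma aug_contr: "aug (contr X) = 0"
  by (simp add: aug_eq_0)

lemma additive_bar_diff: "additive bar_diff"
  by (simp add: bar_diff_eq additive_env_lin)

lemma contr_fscale_right:
  "contr (fscale (single (0, \<beta>) c) X) = fscale (single (0, \<beta>) c) (contr X)"
  by (rule additive_ext2[where F = "\<lambda>X. contr (fscale (single (0, \<beta>) c) X)"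
        and H = "\<lambda>X. fscale (single (0, \<beta>) c) (contr X)"])
    (auto simp: mult_single additive_comp[OF additive_contr additive_fscale]
       additive_comp[OF additive_fscale additive_contr])

lemma aug_fscale:
  "aug (fscale (single (\<alpha>, \<beta>) c) X) = fscale (single (0, \<alpha> + \<beta>) c) (aug X)"
  by (rule additive_ext2[where F = "\<lambda>X. aug (fscale (single (\<alpha>, \<beta>) c) X)"
        and H = "\<lambda>X. fscale (single (0, \<alpha> + \<beta>) c) (aug X)"])
    (auto simp: mult_single ac_simps additive_comp[OF additive_aug additive_fscale]
       additive_comp[OF additive_fscale additive_aug])

lemma aug_aug: "aug (aug X) = aug X"
  by (rule additive_ext2[where F = "\<lambda>X. aug (aug X)" and H = aug])
    (auto simp: aug_0 additive_aug additive_comp[OF additive_aug additive_aug])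

lemma bar_diff_aug: "bar_diff (aug X) = 0"
  by (simp add: aug_def bar_gen_def)

lemma contr_fscale_sign: "contr (fscale ((-1) ^ j) X) = fscale ((-1) ^ j) (contr X)"
  by (cases "even j") (auto simp: fscale_minus_left contr_minus)

text \<open>
  The homotopy identity at a generator, solved for the differential.  The first face gives
  \<open>m \<otimes> ms \<otimes> 1\<close>; the other faces do not touch the leading tensor factor 1, and deleting that factor
  turns them into the faces of \<open>m \<otimes> ms \<otimes> 1\<close> with the opposite sign.  If \<open>ms\<close> is empty, there
  is just one other face, the augmentation term \<open>1 \<otimes> m\<close>.
\<close>

lemma bar_gen_Cons:
  "bar_gen (m # ms) = single ms (single (m, 0) 1) - contr (fscale (single (m, 0) 1) (bar_gen ms))
     - aug (single ms (single (m, 0) 1))"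
proof (cases ms)
  case Nil
  then show ?thesis
    by (simp add: bar_gen_def contr_0 merge_def bar_mon_def fscale_minus_left single_uminus)
next
  case (Cons m1 ms')
  define p where "p = length ms"
  have gen: "bar_gen ms = (\<Sum>j\<le>p. fscale ((-1) ^ j) (bar_mon (merge j (0 # ms @ [0]))))"
    using Cons by (auto simp only: bar_gen_def p_def list.distinct if_False)
  have step: "bar_mon (merge (Suc j) (0 # m # ms @ [0])) =
    contr (fscale (single (m, 0) 1) (bar_mon (merge j (0 # ms @ [0]))))" if "j \<le> p" for j
  proof -
    \<comment> \<open>The faces of \<open>0 # ms\<close> and of \<open>m # ms\<close> differ only in the first entry \<open>z\<close>, which takes part in the merging exactly when \<open>j = 0\<close>.\<close>
    obtain z zs where zs: "merge j (m # ms @ [0]) = z # zs" "zs \<noteq> []"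
      and z0: "merge j (0 # ms @ [0]) = (if j = 0 then z - m else 0) # zs" "j = 0 \<or> z = m"
    proof (cases j)
      case 0
      then show ?thesis using Cons by (intro that) (auto simp: merge_def)
    next
      case (Suc j')
      then show ?thesis using \<open>j \<le> p\<close> Cons by (intro that) (auto simp: merge_def p_def)
    qed
    have z1: "m + (if j = 0 then z - m else 0) = z"
    proof (cases j)
      case 0
      then have "z = m + m1" using zs Cons by (simp add: merge_def)
      then show ?thesis using 0 by simp
    qed (use z0 in auto)
    have "merge (Suc j) (0 # m # ms @ [0]) = 0 # z # zs"
      using zs by (simp add: merge_def)
    then show ?thesis
      using zs(2) z1 by (simp add: bar_mon_def z0 mult_single)
  qed
  have "bar_gen (m # ms) = bar_mon (merge 0 (0 # m # ms @ [0])) +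
      (\<Sum>j\<le>p. fscale ((-1) ^ Suc j) (bar_mon (merge (Suc j) (0 # m # ms @ [0]))))"
    by (simp add: bar_gen_def p_def sum.atMost_Suc_shift del: sum.atMost_Suc power_Suc)
  also have "bar_mon (merge 0 (0 # m # ms @ [0])) = single ms (single (m, 0) 1)"
    by (simp add: merge_def bar_mon_def)
  also have "(\<Sum>j\<le>p. fscale ((-1) ^ Suc j) (bar_mon (merge (Suc j) (0 # m # ms @ [0])))) =
    - (\<Sum>j\<le>p. contr (fscale ((-1) ^ j) (fscale (single (m, 0) 1) (bar_mon (merge j (0 # ms @ [0]))))))"
    unfolding sum_negf[symmetric]
    by (intro sum.cong refl) (simp add: step fscale_minus_left contr_fscale_sign del: fscale_fscale)
  also have "\<dots> = - contr (fscale (single (m, 0) 1) (bar_gen ms))"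
    unfolding gen contr_sum fscale_sum_right fscale_fscale mult.commute[of "single (m, 0) 1"] ..
  finally show ?thesis using Cons by simp
qed

lemma contr_homotopy: "bar_diff (contr X) = X - contr (bar_diff X) - aug X"
proof (rule additive_ext2[where F = "\<lambda>X. bar_diff (contr X)" and H = "\<lambda>X. X - contr (bar_diff X) - aug X"])
  show "additive (\<lambda>X. bar_diff (contr X))"
    by (rule additive_comp[OF additive_bar_diff additive_contr])
  show "additive (\<lambda>X. X - contr (bar_diff X) - aug X)"
    by unfold_locales (simp add: additive.add[OF additive_bar_diff] additive.add[OF additive_aug] contr_add)
next
  fix ms and p :: "mon \<times> mon" and c
  obtain \<alpha> \<beta> where p: "p = (\<alpha>, \<beta>)" by (cases p)
  show "bar_diff (contr (single ms (single p c))) =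
    single ms (single p c) - contr (bar_diff (single ms (single p c))) - aug (single ms (single p c))"
    using contr_fscale_right[of \<beta> c "fscale (single (\<alpha>, 0) 1) (bar_gen ms)"]
    by (simp add: p bar_gen_Cons fscale_diff_right mult_single add.commute)
qed

lemma aug_bar_diff: "aug (bar_diff X) = 0"
proof -
  have "aug (bar_gen ms) = 0" for ms
  proof (cases ms)
    case Nil
    then show ?thesis by (simp add: bar_gen_def aug_0)
  next
    case (Cons m ms')
    then show ?thesis by (simp add: bar_gen_Cons aug_diff aug_contr aug_aug del: aug_single)
  qed
  note gen = this
  show ?thesis
    by (rule additive_ext2[where F = "\<lambda>X. aug (bar_diff X)" and H = "\<lambda>_. 0"])
      (auto simp: gen aug_fscale additive_comp[OF additive_aug additive_bar_diff], unfold_locales, simp)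
qed

text \<open>
  With \<open>d(m # ms) = Z' - s Z\<close> for \<open>Z' = m \<otimes> ms \<otimes> 1\<close> and \<open>Z = d Z'\<close> (up to the augmentation, which
  \<open>d\<close> kills), the homotopy identity gives \<open>d s Z = Z\<close> as soon as \<open>d Z = 0\<close>, which is the induction
  hypothesis.
\<close>

lemma bar_diff_bar_diff: "bar_diff (bar_diff X) = 0"
proof -
  have "bar_diff (bar_gen ms) = 0" for ms
  proof (induction ms)
    case Nil
    then show ?case by (simp add: bar_gen_def bar_diff_eq env_lin_0)
  next
    case (Cons m ms)
    let ?Z = "fscale (single (m, 0) 1) (bar_gen ms)"
    have "bar_diff ?Z = 0" using Cons by (simp add: bar_diff_eq)
    moreover have "aug ?Z = 0" using aug_bar_diff[of "single ms (single (m, 0) 1)"] by simp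
    ultimately have "bar_diff (contr ?Z) = ?Z" by (simp add: contr_homotopy contr_0)
    then show ?case
      by (simp add: bar_gen_Cons additive.diff[OF additive_bar_diff] bar_diff_aug del: aug_single)
  qed
  then show ?thesis unfolding bar_diff_eq env_lin_comp by (simp add: env_lin_def)
qed

section \<open>The chain map property\<close>

definition koszul_gen :: "nat list \<Rightarrow> (nat list \<Rightarrow>\<^sub>0 env)" where
  "koszul_gen I = (\<Sum>k<length I.
     single (take k I @ drop (Suc k) I) ((-1) ^ k * (xvar (I ! k) - yvar (I ! k))))"

lemma koszul_diff_eq: "koszul_diff = env_lin koszul_gen"
  by (simp add: koszul_diff_def koszul_gen_def[abs_def] xvar_def yvar_def)

lemma koszul_diff_single [simp]: "koszul_diff (single I c) = fscale c (koszul_gen I)"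
  by (simp add: koszul_diff_eq)

lemma additive_koszul_diff: "additive koszul_diff"
  by (simp add: koszul_diff_eq additive_env_lin)

lemma koszul_gen_Nil [simp]: "koszul_gen [] = 0"
  by (simp add: koszul_gen_def)

text \<open>
  The Koszul differential is an antiderivation for exterior multiplication by \<open>v\<^sub>i\<close>.
\<close>

lemma koszul_gen_Cons:
  "koszul_gen (i # J) = single J (xvar i - yvar i) - env_lin (\<lambda>J. single (i # J) 1) (koszul_gen J)"
proof -
  have "koszul_gen (i # J) = single J (xvar i - yvar i) +
    (\<Sum>k<length J. single (i # take k J @ drop (Suc k) J) (- ((-1) ^ k * (xvar (J ! k) - yvar (J ! k)))))"
    by (simp add: koszul_gen_def sum.lessThan_Suc_shift del: sum.lessThan_Suc)
  then show ?thesis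
    by (simp add: koszul_gen_def env_lin_sum single_uminus sum_negf)
qed

lemma keys_koszul_gen: "L \<in> keys (koszul_gen I) \<Longrightarrow> set L \<subseteq> set I"
  unfolding koszul_gen_def
  by (drule subsetD[OF keys_sum]) (auto dest!: in_set_takeD in_set_dropD split: if_splits)

lemma prepend_single:
  "prepend i (single J c) = (if \<forall>j\<in>set J. i < j then single (i # J) c else 0)"
  by (simp add: prepend_def)

lemma additive_prepend: "additive (prepend i)"
  unfolding prepend_def by (rule additive_env_lin)

lemma prepend_fscale [simp]: "prepend i (fscale c X) = fscale c (prepend i X)"
  by (simp add: prepend_def)

lemma koszul_diff_fscale [simp]: "koszul_diff (fscale c X) = fscale c (koszul_diff X)"
  by (simp add: koszul_diff_eq)

text \<open>
  Without the truncation in \<open>prepend\<close>, the anticommutator of \<open>d\<close> and \<open>v\<^sub>i \<and> -\<close> would be the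
  multiplication by \<open>x\<^sub>i - y\<^sub>i\<close>.  On an element with first index \<open>j > i\<close> the truncation has no effect.
  If \<open>j \<le> i\<close>, the only surviving term comes from the part of \<open>d\<close> that removes \<open>v\<^sub>j\<close>, so that \<open>v\<^sub>i\<close>
  takes its place.
\<close>

lemma koszul_prepend_prepend:
  "koszul_diff (prepend i (prepend j Y)) + prepend i (koszul_diff (prepend j Y)) =
    (if i < j then fscale (xvar i - yvar i) (prepend j Y) else fscale (xvar j - yvar j) (prepend i Y))"
proof (rule additive_ext[where F = "\<lambda>Y. koszul_diff (prepend i (prepend j Y)) + prepend i (koszul_diff (prepend j Y))"
      and H = "\<lambda>Y. if i < j then fscale (xvar i - yvar i) (prepend j Y) else fscale (xvar j - yvar j) (prepend i Y)"])
  show "additive (\<lambda>Y. koszul_diff (prepend i (prepend j Y)) + prepend i (koszul_diff (prepend j Y)))"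
    by unfold_locales (simp add: additive.add[OF additive_prepend] additive.add[OF additive_koszul_diff])
  show "additive (\<lambda>Y. if i < j then fscale (xvar i - yvar i) (prepend j Y) else fscale (xvar j - yvar j) (prepend i Y))"
    by unfold_locales (simp add: additive.add[OF additive_prepend] fscale_add_right)
next
  fix K
  let ?c = "lookup Y K"
  show "koszul_diff (prepend i (prepend j (single K ?c))) + prepend i (koszul_diff (prepend j (single K ?c))) =
    (if i < j then fscale (xvar i - yvar i) (prepend j (single K ?c))
     else fscale (xvar j - yvar j) (prepend i (single K ?c)))"
  proof (cases "\<forall>k\<in>set K. j < k")
    case jK: True
    show ?thesis
    proof (cases "i < j")
      case True
      then have all: "\<forall>k\<in>set (j # K). i < k" using jK by auto
      have "prepend i (koszul_gen (j # K)) = env_lin (\<lambda>J. single (i # J) 1) (koszul_gen (j # K))"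
        unfolding prepend_def
      proof (rule env_lin_cong)
        fix L assume "L \<in> keys (koszul_gen (j # K))"
        then have "\<forall>l\<in>set L. i < l" using all keys_koszul_gen by blast
        then show "(if \<forall>l\<in>set L. i < l then single (i # L) 1 else 0) = (single (i # L) 1 :: nat list \<Rightarrow>\<^sub>0 env)"
          by simp
      qed
      then show ?thesis
        using True jK all by (simp add: prepend_single koszul_gen_Cons[of i] fscale_diff_right mult.commute)
    next
      case False
      then have "prepend i (env_lin (\<lambda>J. single (j # J) 1) Z) = 0" for Z
        unfolding prepend_def env_lin_comp by (simp add: env_lin_def)
      then show ?thesis
        using False jK by (auto simp: prepend_single koszul_gen_Cons[of j] additive.diff[OF additive_prepend]
            additive.zero[OF additive_koszul_diff] mult.commute)
    qed
  next
    case False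
    then show ?thesis
      by (auto simp: prepend_single additive.zero[OF additive_koszul_diff] additive.zero[OF additive_prepend])
  qed
qed

text \<open>
  The linear map with the generators in product form.  It agrees with \<open>\<Psi>\<close> on monomials in the
  variables \<open>1\<close> to \<open>n\<close>, the only ones on which \<open>\<Psi>\<close> is applied.
\<close>

abbreviation psi :: "nat \<Rightarrow> (mon list \<Rightarrow>\<^sub>0 env) \<Rightarrow> (nat list \<Rightarrow>\<^sub>0 env)" where
  "psi n \<equiv> env_lin (psi_gen n)"

text \<open>
  The leftmost tensor factor is 1 in all terms.  The contracting homotopy followed by \<open>\<Psi>\<close> can be
  computed by the recursion on such elements because the factor by which they are multiplied is then
  the whole first monomial.
\<close>

definition left_normal :: "(mon list \<Rightarrow>\<^sub>0 env) \<Rightarrow> bool" where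
  "left_normal X \<longleftrightarrow> (\<forall>ms. \<forall>p\<in>keys (lookup X ms). fst p = 0)"

lemma left_normal_add: "left_normal X \<Longrightarrow> left_normal Y \<Longrightarrow> left_normal (X + Y)"
  unfolding left_normal_def lookup_add by (auto dest!: subsetD[OF keys_add])

lemma left_normal_0: "left_normal 0"
  by (simp add: left_normal_def)

lemma left_normal_sum: "(\<And>a. a \<in> S \<Longrightarrow> left_normal (f a)) \<Longrightarrow> left_normal (sum f S)"
  by (induction S rule: infinite_finite_induct) (simp_all add: left_normal_add left_normal_0)

lemma left_normal_single: "left_normal (single ms (single (0, \<beta>) c))"
  by (auto simp: left_normal_def lookup_single when_def)

lemma left_normal_contr: "left_normal (contr X)"
  unfolding contr_def by (intro left_normal_sum left_normal_single)

lemma left_normal_aug: "left_normal (aug X)"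
  unfolding aug_def sum_single_fixed[symmetric] by (intro left_normal_sum left_normal_single)

lemma psi_contr:
  assumes "left_normal Y"
  shows "psi n (contr (fscale (single (\<alpha>, 0) 1) Y)) =
    (\<Sum>i=1..n. fscale (divdiff n i \<alpha>) (prepend i (psi n Y)))"
proof (rule additive_ext2[where F = "\<lambda>Y. psi n (contr (fscale (single (\<alpha>, 0) 1) Y))"
      and H = "\<lambda>Y. \<Sum>i=1..n. fscale (divdiff n i \<alpha>) (prepend i (psi n Y))"])
  show "additive (\<lambda>Y. psi n (contr (fscale (single (\<alpha>, 0) 1) Y)))"
    by (rule additive_comp[OF additive_env_lin additive_comp[OF additive_contr additive_fscale]])
  show "additive (\<lambda>Y. \<Sum>i=1..n. fscale (divdiff n i \<alpha>) (prepend i (psi n Y)))"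
    by unfold_locales (simp add: env_lin_add additive.add[OF additive_prepend] fscale_add_right sum.distrib)
next
  fix ms p c assume "ms \<in> keys Y" "p \<in> keys (lookup Y ms)"
  then have "fst p = 0" using assms by (auto simp: left_normal_def)
  then obtain \<beta> where p: "p = (0, \<beta>)" by (cases p) auto
  show "psi n (contr (fscale (single (\<alpha>, 0) 1) (single ms (single p c)))) =
    (\<Sum>i=1..n. fscale (divdiff n i \<alpha>) (prepend i (psi n (single ms (single p c)))))"
    by (simp add: p mult_single psi_gen_Cons fscale_sum_right mult.commute)
qed

text \<open>
  The scalar identity behind the chain map property; \<open>z i\<close> stands for a coordinate of \<open>v\<^sub>i \<and> Y\<close>, and
  the case distinction is that of the anticommutator of \<open>d\<close> and \<open>prepend\<close>.  For fixed \<open>z i\<close> one of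
  the two sums telescopes in each case, and the result combines by the twisted Leibniz rule.
\<close>

lemma divdiff_mon_double_sum:
  fixes x y z :: "nat \<Rightarrow> 'r::comm_ring_1"
  shows "(\<Sum>i=1..n. \<Sum>j=1..n. divdiff_mon x y n i \<alpha> * divdiff_mon x y n j \<beta> *
      (if i < j then (x i - y i) * z j else (x j - y j) * z i)) =
    (\<Sum>i=1..n. (mixed_mon x y n 0 \<alpha> * divdiff_mon x y n i \<beta> - divdiff_mon x y n i (\<alpha> + \<beta>)
      + divdiff_mon x y n i \<alpha> * mixed_mon x y n 0 \<beta>) * z i)"
proof -
  let ?T = "divdiff_mon x y n" and ?E = "mixed_mon x y n"
  have "(\<Sum>i=1..n. \<Sum>j=1..n. ?T i \<alpha> * ?T j \<beta> * (if i < j then (x i - y i) * z j else (x j - y j) * z i)) =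
    (\<Sum>i=1..n. \<Sum>j=1..n. if i < j then ?T j \<beta> * z j * (?T i \<alpha> * (x i - y i)) else 0) +
    (\<Sum>i=1..n. \<Sum>j=1..n. if j \<le> i then ?T i \<alpha> * z i * (?T j \<beta> * (x j - y j)) else 0)"
    unfolding sum.distrib[symmetric] by (intro sum.cong refl) auto
  also have "(\<Sum>i=1..n. \<Sum>j=1..n. if i < j then ?T j \<beta> * z j * (?T i \<alpha> * (x i - y i)) else 0) =
    (\<Sum>j=1..n. ?T j \<beta> * z j * (?E 0 \<alpha> - ?E (j - 1) \<alpha>))"
  proof (subst sum.swap, rule sum.cong[OF refl])
    fix j assume j: "j \<in> {1..n}"
    then have "{i \<in> {1..n}. i < j} = {1..j - 1}" and "j - 1 \<le> n" by auto
    then show "(\<Sum>i=1..n. if i < j then ?T j \<beta> * z j * (?T i \<alpha> * (x i - y i)) else 0) =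
        ?T j \<beta> * z j * (?E 0 \<alpha> - ?E (j - 1) \<alpha>)"
      using divdiff_mon_telescope[of "j - 1" n x y \<alpha>]
      by (simp add: sum.inter_filter[symmetric] sum_distrib_left[symmetric])
  qed
  also have "(\<Sum>i=1..n. \<Sum>j=1..n. if j \<le> i then ?T i \<alpha> * z i * (?T j \<beta> * (x j - y j)) else 0) =
    (\<Sum>i=1..n. ?T i \<alpha> * z i * (?E 0 \<beta> - ?E i \<beta>))"
  proof (rule sum.cong[OF refl])
    fix i assume i: "i \<in> {1..n}"
    then have "{j \<in> {1..n}. j \<le> i} = {1..i}" by auto
    then show "(\<Sum>j=1..n. if j \<le> i then ?T i \<alpha> * z i * (?T j \<beta> * (x j - y j)) else 0) =
        ?T i \<alpha> * z i * (?E 0 \<beta> - ?E i \<beta>)"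
      using i divdiff_mon_telescope[of i n x y \<beta>]
      by (simp add: sum.inter_filter[symmetric] sum_distrib_left[symmetric])
  qed
  finally show ?thesis
    unfolding sum.distrib[symmetric]
    by (simp only:) (intro sum.cong refl, simp add: divdiff_mon_add algebra_simps)
qed

text \<open>
  Induction on the number of monomials.  By the recursion for the bar differential, \<open>\<Psi> d(m # ms)\<close>
  contains \<open>\<Psi> s(m \<cdot> d ms)\<close>.  In \<open>d ms\<close> only the first face multiplies the leftmost tensor factor; it
  merges \<open>m\<close> with the first monomial of \<open>ms\<close>.  The remaining part \<open>W\<close> of \<open>d ms\<close> is left normal,
  so the recursion for \<open>\<Psi>\<close> expresses its contribution through \<open>\<Psi> d ms = d \<Psi> ms\<close>.  What is left
  is an identity between the coefficients of \<open>v\<^sub>i \<and> \<Psi>(ms')\<close>, where \<open>ms'\<close> is the tail of \<open>ms\<close>.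
\<close>

lemma psi_chain_map_gen:
  "ms \<in> mon_lists n (length ms) \<Longrightarrow> koszul_diff (psi_gen n ms) = psi n (bar_gen ms)"
proof (induction ms)
  case Nil
  then show ?case by (simp add: bar_gen_def env_lin_0)
next
  case (Cons m ms)
  let ?T = "divdiff n"
  have m: "m \<in> mons n" and ms: "ms \<in> mon_lists n (length ms)"
    using Cons.prems by (auto simp: mon_lists_Cons)
  note IH = Cons.IH[OF ms]
  show ?case
  proof (cases ms)
    case Nil
    have "koszul_diff (psi_gen n [m]) = single [] (\<Sum>i=1..n. ?T i m * (xvar i - yvar i))"
      by (simp add: psi_gen_Cons prepend_single additive.sum[OF additive_koszul_diff] koszul_gen_Cons
          env_lin_0 sum_single_fixed)
    also have "\<dots> = single [] (single (m, 0) 1 - single (0, m) 1)"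
      by (subst divdiff_mon_telescope) (simp_all add: mixed_mon_first m mixed_mon_last)
    also have "\<dots> = psi n (bar_gen [m])"
      by (simp add: bar_gen_Cons contr_0 env_lin_diff single_diff)
    finally show ?thesis by (simp add: Nil)
  next
    case ms_Cons: (Cons m1 ms')
    define X where "X = (single (m, 0) 1 :: env)"
    define X1 where "X1 = (single (m1, 0) 1 :: env)"
    define Y where "Y = psi_gen n ms'"
    define W where "W = single ms' X1 - bar_gen ms"
    have m1: "m1 \<in> mons n" using ms by (auto simp: ms_Cons mon_lists_Cons)
    have "W = contr (fscale X1 (bar_gen ms')) + aug (single ms' X1)"
      by (simp add: W_def ms_Cons X1_def bar_gen_Cons del: aug_single)
    then have W: "left_normal W"
      by (simp add: left_normal_add left_normal_contr left_normal_aug)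
    have bar_ms: "bar_gen ms = single ms' X1 - W" by (simp add: W_def)
    have XX1: "X * X1 = single (m + m1, 0) 1" by (simp add: X_def X1_def mult_single)
    have psi_W: "psi n W = fscale X1 Y - koszul_diff (psi_gen n ms)"
      by (simp add: W_def env_lin_diff Y_def IH)
    have "bar_gen (m # ms) = single ms X - contr (fscale X (bar_gen ms))"
      by (simp add: bar_gen_Cons ms_Cons X_def)
    also have "\<dots> = single ms X - single ((m + m1) # ms') 1 + contr (fscale X W)"
      unfolding bar_ms fscale_diff_right contr_diff fscale_single XX1
      by (simp add: zero_prod_def[symmetric])
    finally have "psi n (bar_gen (m # ms)) = fscale X (psi_gen n ms) - psi_gen n ((m + m1) # ms')
      + (\<Sum>i=1..n. fscale (?T i m) (prepend i (psi n W)))"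
      by (simp add: env_lin_add env_lin_diff psi_contr[OF W] X_def)
    also have "\<dots> = (\<Sum>i=1..n. fscale (X * ?T i m1) (prepend i Y)) - (\<Sum>i=1..n. fscale (?T i (m + m1)) (prepend i Y))
      + ((\<Sum>i=1..n. fscale (?T i m * X1) (prepend i Y)) - (\<Sum>i=1..n. fscale (?T i m) (prepend i (koszul_diff (psi_gen n ms)))))"
      unfolding psi_W by (simp add: ms_Cons psi_gen_Cons Y_def fscale_sum_right additive.diff[OF additive_prepend]
          fscale_diff_right sum_subtractf)
    also have "\<dots> = (\<Sum>i=1..n. fscale (X * ?T i m1 - ?T i (m + m1) + ?T i m * X1) (prepend i Y))
      - (\<Sum>i=1..n. fscale (?T i m) (prepend i (koszul_diff (psi_gen n ms))))"
      by (simp add: fscale_add_left fscale_diff_left sum.distrib sum_subtractf)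
    \<comment> \<open>The coefficients are those of the scalar identity, read from right to left.\<close>
    also have "(\<Sum>i=1..n. fscale (X * ?T i m1 - ?T i (m + m1) + ?T i m * X1) (prepend i Y)) =
      (\<Sum>i=1..n. \<Sum>j=1..n. fscale (?T i m * ?T j m1)
         (if i < j then fscale (xvar i - yvar i) (prepend j Y) else fscale (xvar j - yvar j) (prepend i Y)))"
    proof (rule poly_mapping_eqI)
      fix L
      show "lookup (\<Sum>i=1..n. fscale (X * ?T i m1 - ?T i (m + m1) + ?T i m * X1) (prepend i Y)) L =
        lookup (\<Sum>i=1..n. \<Sum>j=1..n. fscale (?T i m * ?T j m1)
         (if i < j then fscale (xvar i - yvar i) (prepend j Y) else fscale (xvar j - yvar j) (prepend i Y))) L"
        unfolding lookup_sum lookup_fscale if_distrib[of "\<lambda>Z. lookup Z L"]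
          divdiff_mon_double_sum[where z = "\<lambda>i. lookup (prepend i Y) L"]
        by (simp add: mixed_mon_first m m1 X_def X1_def)
    qed
    also have "\<dots> = (\<Sum>i=1..n. fscale (?T i m)
       (koszul_diff (prepend i (psi_gen n ms)) + prepend i (koszul_diff (psi_gen n ms))))"
      unfolding koszul_prepend_prepend[symmetric] ms_Cons psi_gen_Cons[of n m1] Y_def
      by (simp add: additive.sum[OF additive_koszul_diff] additive.sum[OF additive_prepend]
          fscale_add_right fscale_sum_right sum.distrib)
    finally show ?thesis
      by (simp add: psi_gen_Cons[of n m] additive.sum[OF additive_koszul_diff] fscale_add_right sum.distrib)
  qed
qed

section \<open>Chains in the variables 1 to n\<close>

text \<open>
  The types have variables with arbitrary natural numbers as indices, but \<open>\<Psi>\<close> involves only the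
  indices \<open>1\<close> to \<open>n\<close>.  So every map between the resolutions has to be shown to preserve the
  submodules of elements in these variables.
\<close>

definition Env :: "nat \<Rightarrow> env set" where
  "Env n = {e. keys e \<subseteq> mons n \<times> mons n}"

lemma mons_0: "0 \<in> mons n"
  and mons_add: "\<alpha> \<in> mons n \<Longrightarrow> \<beta> \<in> mons n \<Longrightarrow> \<alpha> + \<beta> \<in> mons n"
  and mons_single: "i \<in> {1..n} \<Longrightarrow> single i c \<in> mons n"
  by (auto simp: mons_def dest!: subsetD[OF keys_add] split: if_splits)

lemma Env_single: "\<alpha> \<in> mons n \<Longrightarrow> \<beta> \<in> mons n \<Longrightarrow> single (\<alpha>, \<beta>) c \<in> Env n"
  by (simp add: Env_def)

lemma Env_0: "0 \<in> Env n"
  by (simp add: Env_def)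

lemma Env_1: "1 \<in> Env n"
  by (simp add: Env_def mons_0 zero_prod_def)

lemma Env_add: "a \<in> Env n \<Longrightarrow> b \<in> Env n \<Longrightarrow> a + b \<in> Env n"
  unfolding Env_def by (auto dest!: subsetD[OF keys_add])

lemma Env_minus: "a \<in> Env n \<Longrightarrow> - a \<in> Env n"
  by (simp add: Env_def)

lemma Env_diff: "a \<in> Env n \<Longrightarrow> b \<in> Env n \<Longrightarrow> a - b \<in> Env n"
  unfolding Env_def by (auto dest!: subsetD[OF keys_diff])

lemma Env_mult:
  assumes "a \<in> Env n" "b \<in> Env n"
  shows "a * b \<in> Env n"
proof -
  have "keys (a * b) \<subseteq> {p + q | p q. p \<in> keys a \<and> q \<in> keys b}" by (rule keys_mult)
  also have "\<dots> \<subseteq> mons n \<times> mons n"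
    using assms by (fastforce simp: Env_def intro: mons_add)
  finally show ?thesis by (simp add: Env_def)
qed

lemma Env_power: "a \<in> Env n \<Longrightarrow> a ^ k \<in> Env n"
  by (induction k) (auto intro: Env_1 Env_mult)

lemma Env_sum: "(\<And>a. a \<in> S \<Longrightarrow> f a \<in> Env n) \<Longrightarrow> sum f S \<in> Env n"
  by (induction S rule: infinite_finite_induct) (auto intro: Env_0 Env_add)

lemma Env_prod: "(\<And>a. a \<in> S \<Longrightarrow> f a \<in> Env n) \<Longrightarrow> prod f S \<in> Env n"
  by (induction S rule: infinite_finite_induct) (auto intro: Env_1 Env_mult)

lemma Env_xvar: "i \<in> {1..n} \<Longrightarrow> xvar i \<in> Env n"
  and Env_yvar: "i \<in> {1..n} \<Longrightarrow> yvar i \<in> Env n"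
  unfolding xvar_def yvar_def by (intro Env_single mons_0 mons_single; simp)+

lemma Env_divdiff: "i \<in> {1..n} \<Longrightarrow> divdiff n i m \<in> Env n"
  unfolding divdiff_mon_def
  by (intro Env_mult Env_prod Env_sum Env_power Env_xvar Env_yvar) auto

lemma free_on_zero [simp]: "0 \<in> free_on W (Env n)"
  by (simp add: free_on_def Env_0)

lemma free_on_add: "x \<in> free_on W (Env n) \<Longrightarrow> y \<in> free_on W (Env n) \<Longrightarrow> x + y \<in> free_on W (Env n)"
  unfolding free_on_def by (auto simp: lookup_add Env_add dest!: subsetD[OF keys_add])

lemma free_on_diff: "x \<in> free_on W (Env n) \<Longrightarrow> y \<in> free_on W (Env n) \<Longrightarrow> x - y \<in> free_on W (Env n)"
  unfolding free_on_def by (auto simp: lookup_minus Env_diff dest!: subsetD[OF keys_diff])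

lemma free_on_sum: "(\<And>a. a \<in> S \<Longrightarrow> f a \<in> free_on W (Env n)) \<Longrightarrow> sum f S \<in> free_on W (Env n)"
  by (induction S rule: infinite_finite_induct) (auto intro: free_on_add)

lemma free_on_single: "w \<in> W \<Longrightarrow> c \<in> Env n \<Longrightarrow> single w c \<in> free_on W (Env n)"
  by (auto simp: free_on_def lookup_single when_def Env_0)

lemma free_on_fscale: "c \<in> Env n \<Longrightarrow> x \<in> free_on W (Env n) \<Longrightarrow> fscale c x \<in> free_on W (Env n)"
  unfolding free_on_def
  by (auto simp: Env_mult) (metis (mono_tags) in_keys_iff lookup_fscale mult_zero_right subsetD)

lemma free_on_env_lin:
  assumes "x \<in> free_on W (Env n)" "\<And>w. w \<in> W \<Longrightarrow> \<phi> w \<in> free_on U (Env n)"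
  shows "env_lin \<phi> x \<in> free_on U (Env n)"
  unfolding env_lin_def using assms
  by (intro free_on_sum free_on_fscale) (auto simp: free_on_def)

lemma free_on_contr:
  assumes "X \<in> free_on (mon_lists n p) (Env n)"
  shows "contr X \<in> free_on (mon_lists n (Suc p)) (Env n)"
  unfolding contr_def
proof (intro free_on_sum free_on_single Env_single mons_0)
  fix ms p' assume "ms \<in> keys X" "p' \<in> keys (lookup X ms)"
  then have "ms \<in> mon_lists n p" "p' \<in> mons n \<times> mons n"
    using assms unfolding free_on_def Env_def by blast+
  then show "fst p' # ms \<in> mon_lists n (Suc p)" "snd p' \<in> mons n" by (auto simp: mon_lists_Cons)
qed

lemma free_on_bar_gen:
  "ms \<in> mon_lists n (Suc p) \<Longrightarrow> bar_gen ms \<in> free_on (mon_lists n p) (Env n)"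
proof (induction p arbitrary: ms)
  case 0
  then obtain m where ms: "ms = [m]" and m: "m \<in> mons n"
    by (cases ms) (auto simp: mon_lists_def)
  show ?case
    unfolding ms bar_gen_Cons
    by (auto simp: contr_0 intro!: free_on_diff free_on_single Env_single mons_0 m)
next
  case (Suc p)
  then obtain m ms' where ms: "ms = m # ms'" and m: "m \<in> mons n" and ms': "ms' \<in> mon_lists n (Suc p)"
    by (cases ms) (auto simp: mon_lists_def)
  then have "ms' \<noteq> []" by (auto simp: mon_lists_def)
  then show ?case
    unfolding ms bar_gen_Cons
    by (auto intro!: free_on_diff free_on_single free_on_contr free_on_fscale Suc.IH Env_single mons_0 m ms')
qed

lemma incr_remove:
  assumes "I \<in> incr n (Suc p)" "k < Suc p"
  shows "take k I @ drop (Suc k) I \<in> incr n p"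
proof -
  have "sorted_wrt (<) (take k I @ I ! k # drop (Suc k) I)"
    using assms id_take_nth_drop[of k I] by (simp add: incr_def)
  then have "sorted_wrt (<) (take k I @ drop (Suc k) I)"
    by (simp add: sorted_wrt_append)
  moreover have "set (take k I @ drop (Suc k) I) \<subseteq> {1..n}"
    using assms by (auto simp: incr_def dest!: in_set_takeD in_set_dropD)
  ultimately show ?thesis using assms by (auto simp: incr_def)
qed

lemma incr_nth: "I \<in> incr n p \<Longrightarrow> k < p \<Longrightarrow> I ! k \<in> {1..n}"
  unfolding incr_def using nth_mem by blast

lemma free_on_koszul_gen:
  "I \<in> incr n (Suc p) \<Longrightarrow> koszul_gen I \<in> free_on (incr n p) (Env n)"
  unfolding koszul_gen_def
  by (intro free_on_sum free_on_single Env_mult Env_power Env_diff Env_minus Env_1 Env_xvar Env_yvar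
      incr_remove incr_nth) (auto simp: incr_length)

lemma free_on_psi_gen:
  assumes "ms \<in> mon_lists n p"
  shows "psi_gen n ms \<in> free_on (incr n p) (Env n)"
proof -
  have Env: "prod_list (map2 (divdiff n) I ms) \<in> Env n" if "set I \<subseteq> {1..n}" for I
    using that
  proof (induction I arbitrary: ms)
    case (Cons i I)
    then show ?case by (cases ms) (auto simp: Env_1 intro!: Env_mult Env_divdiff)
  qed (simp add: Env_1)
  have "length ms = p" using assms by (simp add: mon_lists_def)
  then show ?thesis
    unfolding psi_gen_def by (intro free_on_sum free_on_single Env) (auto simp: incr_def)
qed

lemma psi_chain_map:
  assumes "X \<in> free_on (mon_lists n p) (Env n)"
  shows "koszul_diff (psi n X) = psi n (bar_diff X)"
proof -
  have "env_lin (\<lambda>ms. koszul_diff (psi_gen n ms)) X = env_lin (\<lambda>ms. psi n (bar_gen ms)) X"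
    using assms by (intro env_lin_cong psi_chain_map_gen) (auto simp: free_on_def mon_lists_def)
  then show ?thesis by (simp add: koszul_diff_eq bar_diff_eq env_lin_comp)
qed

section \<open>A homotopy inverse of the chain map\<close>

text \<open>
  The map of the comparison theorem from the Koszul to the bar resolution.  The
  degree \<open>p\<close> is a separate argument to make the recursion primitive; on the generators it is
  the length of the list of indices.
\<close>

primrec phi_gen :: "nat \<Rightarrow> nat list \<Rightarrow> (mon list \<Rightarrow>\<^sub>0 env)" where
  "phi_gen 0 I = single [] 1"
| "phi_gen (Suc p) I = contr (env_lin (phi_gen p) (koszul_gen I))"

abbreviation phi :: "nat \<Rightarrow> (nat list \<Rightarrow>\<^sub>0 env) \<Rightarrow> (mon list \<Rightarrow>\<^sub>0 env)" where
  "phi p \<equiv> env_lin (phi_gen p)"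

lemma left_normal_phi_gen: "left_normal (phi_gen p I)"
  using left_normal_single[of "[]" 0 1] by (cases p) (auto simp: left_normal_contr zero_prod_def[symmetric])

lemma free_on_phi_gen:
  "I \<in> incr n p \<Longrightarrow> phi_gen p I \<in> free_on (mon_lists n p) (Env n)"
proof (induction p arbitrary: I)
  case 0
  then show ?case by (simp add: free_on_single Env_1)
next
  case (Suc p)
  then show ?case
    by (auto intro!: free_on_contr free_on_env_lin[OF free_on_koszul_gen])
qed

lemma divdiff_0 [simp]: "divdiff n i 0 = 0"
  by (simp add: divdiff_mon_def)

text \<open>
  The divided differences of a variable vanish except for one, which is 1.  The multiple by \<open>y\<^sub>k\<close> is
  pulled out of the contracting homotopy, and what remains has the monomial 1 in its first position,
  where all divided differences vanish.
\<close>

lemma psi_contr_var: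
  assumes "left_normal Y" "k \<in> {1..n}"
  shows "psi n (contr (fscale (xvar k - yvar k) Y)) = prepend k (psi n Y)"
proof -
  have "psi n (contr (fscale (xvar k) Y)) = (\<Sum>i=1..n. if i = k then prepend k (psi n Y) else 0)"
    unfolding xvar_def psi_contr[OF assms(1)] using assms(2)
    by (intro sum.cong refl) (simp only: divdiff_mon_single, simp)
  moreover have "psi n (contr Y) = 0"
    using psi_contr[OF assms(1), of n 0] by (simp flip: zero_prod_def)
  ultimately show ?thesis
    using assms(2) by (simp add: fscale_diff_left contr_diff yvar_def contr_fscale_right env_lin_diff)
qed

text \<open>
  Unfolding \<open>\<Phi>\<close> once, the summand with index \<open>k\<close> puts \<open>v\<close> with index \<open>I ! k\<close> in front of
  the list \<open>I\<close> without that index.  This is increasing only for \<open>k = 0\<close>, where it restores \<open>I\<close>.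
\<close>

lemma psi_phi_gen:
  "I \<in> incr n p \<Longrightarrow> psi n (phi_gen p I) = single I 1"
proof (induction p arbitrary: I)
  case 0
  then show ?case by simp
next
  case (Suc p)
  let ?J = "\<lambda>k. take k I @ drop (Suc k) I"
  have len: "length I = Suc p" and sorted: "sorted_wrt (<) I" using Suc.prems by (auto simp: incr_def)
  have "psi n (phi_gen (Suc p) I) =
    (\<Sum>k<Suc p. psi n (contr (fscale ((-1) ^ k) (fscale (xvar (I ! k) - yvar (I ! k)) (phi_gen p (?J k))))))"
    by (simp only: phi_gen.simps koszul_gen_def env_lin_sum env_lin_single contr_sum len fscale_fscale)
  also have "\<dots> = (\<Sum>k<Suc p. fscale ((-1) ^ k) (prepend (I ! k) (psi n (phi_gen p (?J k)))))"
    unfolding contr_fscale_sign env_lin_fscale using Suc.prems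
    by (intro sum.cong refl arg_cong[where f = "fscale _"] psi_contr_var left_normal_phi_gen incr_nth) auto
  also have "\<dots> = (\<Sum>k<Suc p. fscale ((-1) ^ k) (prepend (I ! k) (single (?J k) 1)))"
    using Suc.prems by (intro sum.cong refl) (simp add: Suc.IH incr_remove)
  also have "\<dots> = (\<Sum>k<Suc p. if k = 0 then single I 1 else 0)"
  proof (rule sum.cong[OF refl])
    fix k assume k: "k \<in> {..<Suc p}"
    obtain i J where I: "I = i # J" using len by (cases I) auto
    show "fscale ((-1) ^ k) (prepend (I ! k) (single (?J k) 1)) = (if k = 0 then single I 1 else 0)"
    proof (cases k)
      case 0
      then show ?thesis using sorted by (simp add: I prepend_single)
    next
      case (Suc k')
      have "i < J ! k'" using sorted k len by (simp add: I Suc)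
      then show ?thesis by (auto simp: I Suc prepend_single)
    qed
  qed
  finally show ?case by simp
qed

text \<open>
  The Koszul complex is a retract of the bar complex, so \<open>d d = 0\<close> is inherited:
  \<open>d d = d d \<Psi> \<Phi> = \<Psi> d d \<Phi> = 0\<close>.  Only the chain map property of \<open>\<Psi>\<close> enters here, which makes
  the result available for that of \<open>\<Phi>\<close>.
\<close>

lemma koszul_diff_koszul_gen:
  assumes "I \<in> incr n (Suc p)"
  shows "koszul_diff (koszul_gen I) = 0"
proof -
  have phi: "phi_gen (Suc p) I \<in> free_on (mon_lists n (Suc p)) (Env n)"
    using assms by (rule free_on_phi_gen)
  then have "bar_diff (phi_gen (Suc p) I) \<in> free_on (mon_lists n p) (Env n)"
    unfolding bar_diff_eq by (rule free_on_env_lin) (rule free_on_bar_gen)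
  note bar = psi_chain_map[OF this]
  have "koszul_gen I = koszul_diff (psi n (phi_gen (Suc p) I))"
    using assms by (simp add: psi_phi_gen del: phi_gen.simps)
  also have "\<dots> = psi n (bar_diff (phi_gen (Suc p) I))"
    by (rule psi_chain_map[OF phi])
  finally show ?thesis by (simp add: bar bar_diff_bar_diff env_lin_0 del: phi_gen.simps)
qed

lemma aug_env_lin:
  "(\<And>w. lookup (\<phi> w) [] = 0) \<Longrightarrow> aug (env_lin \<phi> X) = 0"
  by (rule aug_eq_0) (simp add: env_lin_def lookup_sum)

text \<open>
  The homotopy identity gives \<open>d s Z = Z\<close> for the cycle \<open>Z = \<Phi> d I\<close>; it is a cycle by induction and
  \<open>d d = 0\<close>.  In degree zero \<open>Z = x\<^sub>i - y\<^sub>i\<close> lies in the kernel of the augmentation.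
\<close>

lemma phi_chain_map_gen:
  "I \<in> incr n (Suc p) \<Longrightarrow> bar_diff (phi_gen (Suc p) I) = phi p (koszul_gen I)"
proof (induction p arbitrary: I)
  case 0
  then obtain i where I: "I = [i]" by (auto simp: incr_def length_Suc_conv)
  have "phi 0 (koszul_gen I) = single [] (xvar i) - single [] (yvar i)"
    by (simp add: I koszul_gen_Cons env_lin_0 env_lin_diff single_diff)
  then show ?case
    unfolding phi_gen.simps(2)[of 0] contr_homotopy
    by (simp add: additive.diff[OF additive_bar_diff] contr_0 xvar_def yvar_def aug_diff del: phi_gen.simps)
next
  case (Suc p)
  let ?Z = "phi (Suc p) (koszul_gen I)"
  have "bar_diff ?Z = env_lin (\<lambda>J. bar_diff (phi_gen (Suc p) J)) (koszul_gen I)"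
    by (simp add: bar_diff_eq env_lin_comp)
  also have "\<dots> = env_lin (\<lambda>J. phi p (koszul_gen J)) (koszul_gen I)"
    using free_on_koszul_gen[OF Suc.prems] by (intro env_lin_cong Suc.IH) (auto simp: free_on_def)
  also have "\<dots> = phi p (koszul_diff (koszul_gen I))"
    by (simp add: koszul_diff_eq env_lin_comp)
  also have "\<dots> = 0" by (simp add: koszul_diff_koszul_gen[OF Suc.prems] env_lin_0)
  finally have "bar_diff ?Z = 0" .
  moreover have "aug ?Z = 0" by (rule aug_env_lin) simp
  ultimately show ?case
    unfolding phi_gen.simps(2)[of "Suc p"] contr_homotopy by (simp add: contr_0 del: phi_gen.simps)
qed

lemma phi_chain_map:
  assumes "X \<in> free_on (incr n (Suc p)) (Env n)"
  shows "bar_diff (phi (Suc p) X) = phi p (koszul_diff X)"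
proof -
  have "env_lin (\<lambda>I. bar_diff (phi_gen (Suc p) I)) X = env_lin (\<lambda>I. phi p (koszul_gen I)) X"
    using assms by (intro env_lin_cong phi_chain_map_gen) (auto simp: free_on_def)
  then show ?thesis by (simp add: koszul_diff_eq bar_diff_eq env_lin_comp)
qed

text \<open>
  The homotopy of the comparison theorem between the identity and \<open>\<Phi> \<Psi>\<close>.  It vanishes in degree
  zero because the two maps agree there.
\<close>

primrec htpy_gen :: "nat \<Rightarrow> nat \<Rightarrow> mon list \<Rightarrow> (mon list \<Rightarrow>\<^sub>0 env)" where
  "htpy_gen n 0 ms = 0"
| "htpy_gen n (Suc p) ms = contr (single ms 1 - phi (Suc p) (psi_gen n ms) - env_lin (htpy_gen n p) (bar_gen ms))"

lemma lookup_htpy_gen_Nil: "lookup (htpy_gen n p ms) [] = 0"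
  by (cases p) auto

lemma free_on_htpy_gen:
  "ms \<in> mon_lists n p \<Longrightarrow> htpy_gen n p ms \<in> free_on (mon_lists n (Suc p)) (Env n)"
proof (induction p arbitrary: ms)
  case (Suc p)
  then show ?case
    unfolding htpy_gen.simps(2)
    by (intro free_on_contr free_on_diff free_on_single Env_1 free_on_env_lin[OF free_on_psi_gen]
        free_on_phi_gen free_on_env_lin[OF free_on_bar_gen]) auto
qed simp

lemma htpy_gen:
  "ms \<in> mon_lists n p \<Longrightarrow>
    bar_diff (htpy_gen n p ms) + env_lin (htpy_gen n (p - 1)) (bar_gen ms) = single ms 1 - phi p (psi_gen n ms)"
proof (induction p arbitrary: ms)
  case 0
  then show ?case by (simp add: bar_diff_eq env_lin_0)
next
  case (Suc p)
  \<comment> \<open>The recursion is chosen so that \<open>Y\<close> is a cycle without component in degree zero, hence \<open>d s Y = Y\<close>.\<close>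
  define Y where "Y = single ms 1 - phi (Suc p) (psi_gen n ms) - env_lin (htpy_gen n p) (bar_gen ms)"
  have X: "bar_gen ms \<in> free_on (mon_lists n p) (Env n)" by (rule free_on_bar_gen[OF Suc.prems])
  have "env_lin (\<lambda>ks. bar_diff (htpy_gen n p ks) + env_lin (htpy_gen n (p - 1)) (bar_gen ks)) (bar_gen ms) =
    env_lin (\<lambda>ks. single ks 1 - phi p (psi_gen n ks)) (bar_gen ms)"
    using X by (intro env_lin_cong Suc.IH) (auto simp: free_on_def)
  moreover have "env_lin (\<lambda>w. f w + h w) Z = env_lin f Z + env_lin h Z"
    "env_lin (\<lambda>w. f w - h w) Z = env_lin f Z - env_lin h Z" for f h :: "mon list \<Rightarrow> (mon list \<Rightarrow>\<^sub>0 env)" and Z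
    by (simp_all add: env_lin_def fscale_add_right fscale_diff_right sum.distrib sum_subtractf)
  ultimately have "bar_diff (env_lin (htpy_gen n p) (bar_gen ms)) + env_lin (htpy_gen n (p - 1)) (bar_diff (bar_gen ms))
    = bar_gen ms - phi p (psi n (bar_gen ms))"
    by (simp add: bar_diff_eq env_lin_comp env_lin_basis)
  moreover have "bar_diff (bar_gen ms) = 0"
    using bar_diff_bar_diff[of "single ms 1"] by simp
  ultimately have h: "bar_diff (env_lin (htpy_gen n p) (bar_gen ms)) = bar_gen ms - phi p (psi n (bar_gen ms))"
    by (simp add: env_lin_0)
  have "bar_diff (phi (Suc p) (psi_gen n ms)) = phi p (psi n (bar_gen ms))"
    unfolding phi_chain_map[OF free_on_psi_gen[OF Suc.prems]]
    using Suc.prems by (subst psi_chain_map_gen) (auto simp: mon_lists_def)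
  with h have "bar_diff Y = 0"
    by (simp add: Y_def additive.diff[OF additive_bar_diff])
  moreover have "aug (phi (Suc p) (psi_gen n ms)) = 0" by (rule aug_env_lin) simp
  moreover have "aug (env_lin (htpy_gen n p) (bar_gen ms)) = 0"
    by (rule aug_env_lin) (rule lookup_htpy_gen_Nil)
  moreover have "aug (single ms 1) = 0"
    using Suc.prems by (intro aug_eq_0) (auto simp: lookup_single when_def mon_lists_def)
  ultimately have "bar_diff (contr Y) = Y"
    by (simp add: contr_homotopy contr_0 Y_def aug_diff)
  then show ?case by (simp add: Y_def del: phi_gen.simps)
qed

section \<open>Tensoring with the twisted bimodule\<close>

lemma Sym_0: "0 \<in> Sym n"
  by (simp add: Sym_def)

lemma Sym_1: "1 \<in> Sym n"
  by (simp add: Sym_def mons_0)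

lemma Sym_add: "a \<in> Sym n \<Longrightarrow> b \<in> Sym n \<Longrightarrow> a + b \<in> Sym n"
  unfolding Sym_def by (auto dest!: subsetD[OF keys_add])

lemma Sym_diff: "a \<in> Sym n \<Longrightarrow> b \<in> Sym n \<Longrightarrow> a - b \<in> Sym n"
  unfolding Sym_def by (auto dest!: subsetD[OF keys_diff])

lemma Sym_mult:
  assumes "a \<in> Sym n" "b \<in> Sym n"
  shows "a * b \<in> Sym n"
proof -
  have "keys (a * b) \<subseteq> {p + q | p q. p \<in> keys a \<and> q \<in> keys b}" by (rule keys_mult)
  also have "\<dots> \<subseteq> mons n"
    using assms by (fastforce simp: Sym_def intro: mons_add)
  finally show ?thesis by (simp add: Sym_def)
qed

lemma Sym_power: "a \<in> Sym n \<Longrightarrow> a ^ k \<in> Sym n"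
  by (induction k) (auto intro: Sym_1 Sym_mult)

lemma Sym_sum: "(\<And>a. a \<in> S \<Longrightarrow> f a \<in> Sym n) \<Longrightarrow> sum f S \<in> Sym n"
  by (induction S rule: infinite_finite_induct) (auto intro: Sym_0 Sym_add)

lemma Sym_prod: "(\<And>a. a \<in> S \<Longrightarrow> f a \<in> Sym n) \<Longrightarrow> prod f S \<in> Sym n"
  by (induction S rule: infinite_finite_induct) (auto intro: Sym_1 Sym_mult)

lemma Sym_single: "\<alpha> \<in> mons n \<Longrightarrow> single \<alpha> c \<in> Sym n"
  by (simp add: Sym_def)

lemma Sym_cst: "cst c \<in> Sym n"
  unfolding cst_def by (rule Sym_single) (rule mons_0)

lemma Sym_var: "i \<in> {1..n} \<Longrightarrow> var i \<in> Sym n"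
  unfolding var_def by (intro Sym_single mons_single)

text \<open>
  What the homological part needs to know of the bimodule: on the elements \<open>f\<close> tensor \<open>g\<close> the
  enveloping algebra acts through a ring homomorphism \<open>\<theta>\<close> into the polynomials, followed by
  multiplication.  Tensoring with the bimodule is then the extension of scalars along \<open>\<theta>\<close>.
\<close>

locale env_twist =
  fixes G :: "('g, 'b) monoid_scheme" and A :: "'g \<Rightarrow> pol \<Rightarrow> pol" and g :: 'g and n :: nat
    and \<theta> :: "env \<Rightarrow> pol"
  assumes env_act_single: "f \<in> Sym n \<Longrightarrow> env_act G A e (single g f) = single g (\<theta> e * f)"
    and additive_env_act: "additive (env_act G A e)"
    and \<theta>_additive: "additive \<theta>"
    and \<theta>_mult: "\<theta> (e * e') = \<theta> e * \<theta> e'"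
    and \<theta>_one: "\<theta> 1 = 1"
    and \<theta>_Sym: "e \<in> Env n \<Longrightarrow> \<theta> e \<in> Sym n"
begin

abbreviation chains :: "'w set \<Rightarrow> ('w \<Rightarrow>\<^sub>0 'g skew) set" where
  "chains W \<equiv> free_on W (Sym_at n g)"

definition coef :: "('w \<Rightarrow>\<^sub>0 'g skew) \<Rightarrow> 'w \<Rightarrow> pol" where
  "coef y w = lookup (lookup y w) g"

lemma chains_lookup:
  assumes "y \<in> chains W"
  shows "lookup y w = single g (coef y w)" "coef y w \<in> Sym n"
proof -
  have "lookup y w \<in> Sym_at n g" using assms by (simp add: free_on_def)
  then obtain f where f: "f \<in> Sym n" "lookup y w = single g f" by (auto simp: Sym_at_def)
  then show "lookup y w = single g (coef y w)" "coef y w \<in> Sym n" by (simp_all add: coef_def)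
qed

lemma coef_eq_0: "w \<notin> keys y \<Longrightarrow> coef y w = 0"
  by (simp add: coef_def in_keys_iff)

lemma env_act_0: "env_act G A 0 m = 0"
  by (simp add: env_act_def)

lemma additive_env_tensor: "additive (\<lambda>m. env_tensor G A m z)"
  unfolding env_tensor_def
  by unfold_locales (simp add: additive.add[OF additive_env_act] single_add sum.distrib)

lemma additive_tensor_map: "additive (tensor_map G A F)"
  unfolding tensor_map_def[abs_def]
  by (rule additive_sum_keys) (rule additive_env_tensor)

text \<open>
  In coordinates, a map after tensoring is given by the matrix obtained by applying \<open>\<theta>\<close> to the
  entries of the original matrix.  All further properties of \<open>tensor_map\<close> are read off from this.
\<close>

lemma lookup_tensor_map:
  assumes "y \<in> chains W"
  shows "lookup (tensor_map G A F y) u =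
    single g (\<Sum>w\<in>keys y. \<theta> (lookup (F (single w 1)) u) * coef y w)"
proof -
  have "lookup (env_tensor G A m z) u = env_act G A (lookup z u) m" for m z
    unfolding env_tensor_def lookup_sum lookup_single
    by (auto simp: when_def sum.delta env_act_0 in_keys_iff cong: if_cong)
  then have "lookup (tensor_map G A F y) u = (\<Sum>w\<in>keys y. env_act G A (lookup (F (single w 1)) u) (lookup y w))"
    by (simp add: tensor_map_def lookup_sum)
  also have "\<dots> = (\<Sum>w\<in>keys y. single g (\<theta> (lookup (F (single w 1)) u) * coef y w))"
    using chains_lookup[OF assms] by (simp add: env_act_single)
  finally show ?thesis
    by (simp add: sum_single_fixed)
qed

lemma coef_tensor_map:
  assumes "y \<in> chains W" "finite S" "keys y \<subseteq> S"
  shows "coef (tensor_map G A F y) u = (\<Sum>w\<in>S. \<theta> (lookup (F (single w 1)) u) * coef y w)"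
proof -
  have "coef (tensor_map G A F y) u = (\<Sum>w\<in>keys y. \<theta> (lookup (F (single w 1)) u) * coef y w)"
    by (simp add: coef_def[of "tensor_map G A F y"] lookup_tensor_map[OF assms(1)])
  also have "\<dots> = (\<Sum>w\<in>S. \<theta> (lookup (F (single w 1)) u) * coef y w)"
    using assms by (intro sum.mono_neutral_left) (auto simp: coef_eq_0)
  finally show ?thesis .
qed

lemma tensor_map_chains:
  assumes y: "y \<in> chains W" and F: "\<And>w. w \<in> W \<Longrightarrow> F (single w 1) \<in> free_on U (Env n)"
  shows "tensor_map G A F y \<in> chains U"
proof -
  have W: "w \<in> W" if "w \<in> keys y" for w using y that by (auto simp: free_on_def)
  have "u \<in> U" if "u \<in> keys (tensor_map G A F y)" for u
  proof (rule ccontr)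
    assume "u \<notin> U"
    then have "lookup (F (single w 1)) u = 0" if "w \<in> keys y" for w
      using F[OF W[OF that]] by (auto simp: free_on_def in_keys_iff)
    then have "lookup (tensor_map G A F y) u = 0"
      by (simp add: lookup_tensor_map[OF y] additive.zero[OF \<theta>_additive])
    with that show False by (simp add: in_keys_iff)
  qed
  moreover have "lookup (tensor_map G A F y) u \<in> Sym_at n g" for u
    unfolding lookup_tensor_map[OF y] Sym_at_def
    by (intro imageI Sym_sum Sym_mult \<theta>_Sym) (use F W y chains_lookup[OF y] in \<open>auto simp: free_on_def\<close>)
  ultimately show ?thesis by (auto simp: free_on_def)
qed

lemma tensor_map_cong:
  assumes y: "y \<in> chains W" and eq: "\<And>w. w \<in> W \<Longrightarrow> F (single w 1) = F' (single w 1)"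
  shows "tensor_map G A F y = tensor_map G A F' y"
proof (rule poly_mapping_eqI)
  fix u
  show "lookup (tensor_map G A F y) u = lookup (tensor_map G A F' y) u"
    unfolding lookup_tensor_map[OF y] using y
    by (intro arg_cong[where f = "single g"] sum.cong refl) (auto simp: eq free_on_def)
qed

lemma tensor_map_0: "tensor_map G A (\<lambda>_. 0) y = 0"
  by (simp add: tensor_map_def env_tensor_def)

lemma tensor_map_add:
  assumes y: "y \<in> chains W"
  shows "tensor_map G A (\<lambda>x. F x + F' x) y = tensor_map G A F y + tensor_map G A F' y"
  by (rule poly_mapping_eqI)
    (simp add: lookup_tensor_map[OF y] lookup_add additive.add[OF \<theta>_additive] distrib_right sum.distrib single_add)

lemma tensor_map_diff:
  assumes y: "y \<in> chains W"
  shows "tensor_map G A (\<lambda>x. F x - F' x) y = tensor_map G A F y - tensor_map G A F' y"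
  by (rule poly_mapping_eqI)
    (simp add: lookup_tensor_map[OF y] lookup_minus additive.diff[OF \<theta>_additive] left_diff_distrib
      sum_subtractf single_diff)

lemma tensor_map_id:
  assumes y: "y \<in> chains W"
  shows "tensor_map G A (\<lambda>x. x) y = y"
proof (rule poly_mapping_eqI)
  fix u
  have "lookup (tensor_map G A (\<lambda>x. x) y) u = single g (\<Sum>w\<in>keys y. if w = u then coef y w else 0)"
    unfolding lookup_tensor_map[OF y]
    by (intro arg_cong[where f = "single g"] sum.cong refl)
      (auto simp: lookup_single when_def \<theta>_one additive.zero[OF \<theta>_additive])
  also have "\<dots> = single g (coef y u)"
    by (simp add: sum.delta coef_eq_0)
  finally show "lookup (tensor_map G A (\<lambda>x. x) y) u = lookup y u"
    by (simp add: chains_lookup(1)[OF y, symmetric])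
qed

text \<open>
  Functoriality is the multiplicativity of matrices, which \<open>\<theta>\<close> preserves as a ring homomorphism.
\<close>

lemma tensor_map_comp:
  assumes y: "y \<in> chains W" and H: "\<And>w. w \<in> W \<Longrightarrow> H (single w 1) \<in> free_on U (Env n)"
  shows "tensor_map G A (env_lin \<phi>) (tensor_map G A H y) = tensor_map G A (\<lambda>x. env_lin \<phi> (H x)) y"
proof -
  have Hy: "tensor_map G A H y \<in> chains U" by (rule tensor_map_chains[where F = H, OF y]) (rule H)
  define S where "S = keys (tensor_map G A H y) \<union> (\<Union>w\<in>keys y. keys (H (single w 1)))"
  have S: "finite S" "keys (tensor_map G A H y) \<subseteq> S" by (auto simp: S_def)
  have "\<theta> (lookup (env_lin \<phi> (H (single w 1))) t) = (\<Sum>u\<in>S. \<theta> (lookup (\<phi> u) t) * \<theta> (lookup (H (single w 1)) u))"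
    if "w \<in> keys y" for w t
  proof -
    have "env_lin \<phi> (H (single w 1)) = (\<Sum>u\<in>S. fscale (lookup (H (single w 1)) u) (\<phi> u))"
      using S(1) that by (intro env_lin_superset) (auto simp: S_def)
    then show ?thesis by (simp add: lookup_sum additive.sum[OF \<theta>_additive] \<theta>_mult mult.commute)
  qed
  note comp = this
  show ?thesis
  proof (rule poly_mapping_eqI)
    fix t
    have "(\<Sum>u\<in>keys (tensor_map G A H y). \<theta> (lookup (\<phi> u) t) * coef (tensor_map G A H y) u)
      = (\<Sum>u\<in>S. \<theta> (lookup (\<phi> u) t) * coef (tensor_map G A H y) u)"
      using S by (intro sum.mono_neutral_left) (auto simp: coef_eq_0)
    also have "\<dots> = (\<Sum>u\<in>S. \<Sum>w\<in>keys y. \<theta> (lookup (\<phi> u) t) * \<theta> (lookup (H (single w 1)) u) * coef y w)"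
      by (simp add: coef_tensor_map[OF y finite_keys order_refl] sum_distrib_left mult.assoc)
    also have "\<dots> = (\<Sum>w\<in>keys y. \<theta> (lookup (env_lin \<phi> (H (single w 1))) t) * coef y w)"
      by (subst sum.swap) (simp add: comp sum_distrib_right)
    finally show "lookup (tensor_map G A (env_lin \<phi>) (tensor_map G A H y)) t =
        lookup (tensor_map G A (\<lambda>x. env_lin \<phi> (H x)) y) t"
      by (simp add: lookup_tensor_map[OF y] lookup_tensor_map[OF Hy])
  qed
qed

lemma coef_cscale: "coef (cscale c y) w = cst c * coef y w"
  and lookup_cscale: "lookup (cscale c y) w = fscale (cst c) (lookup y w)"
  by (auto simp: cscale_def coef_def Poly_Mapping.map.rep_eq when_def)

lemma cscale_chains:
  assumes "y \<in> chains W"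
  shows "cscale c y \<in> chains W"
proof -
  have "lookup (cscale c y) w \<in> Sym_at n g" for w
    using chains_lookup[OF assms, of w] by (auto simp: lookup_cscale Sym_at_def intro!: imageI Sym_mult Sym_cst)
  moreover have "keys (cscale c y) \<subseteq> W"
    using assms unfolding free_on_def by (auto simp: in_keys_iff lookup_cscale) (metis fscale_0_right in_keys_iff subsetD)
  ultimately show ?thesis by (simp add: free_on_def)
qed

lemma tensor_map_cscale:
  assumes y: "y \<in> chains W"
  shows "tensor_map G A F (cscale c y) = cscale c (tensor_map G A F y)"
proof (rule poly_mapping_eqI)
  fix u
  have "keys (cscale c y) \<subseteq> keys y"
    by (auto simp: in_keys_iff lookup_cscale)
  then have "(\<Sum>w\<in>keys (cscale c y). \<theta> (lookup (F (single w 1)) u) * coef (cscale c y) w) =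
    (\<Sum>w\<in>keys y. \<theta> (lookup (F (single w 1)) u) * coef (cscale c y) w)"
    by (intro sum.mono_neutral_left) (auto simp: coef_eq_0)
  then show "lookup (tensor_map G A F (cscale c y)) u = lookup (cscale c (tensor_map G A F y)) u"
    by (simp add: lookup_tensor_map[OF cscale_chains[OF y]] lookup_tensor_map[OF y] lookup_cscale
        coef_cscale sum_distrib_left ac_simps)
qed

lemma add_closed_chains: "x \<in> chains W \<Longrightarrow> y \<in> chains W \<Longrightarrow> x - y \<in> chains W" "0 \<in> chains W"
proof -
  assume xy: "x \<in> chains W" "y \<in> chains W"
  have "lookup (x - y) w \<in> Sym_at n g" for w
    using chains_lookup[OF xy(1)] chains_lookup[OF xy(2)]
    by (auto simp: lookup_minus single_diff[symmetric] Sym_at_def intro!: imageI Sym_diff)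
  then show "x - y \<in> chains W"
    using xy by (auto simp: free_on_def dest!: subsetD[OF keys_diff])
next
  show "0 \<in> chains W" using Sym_0 by (force simp: free_on_def Sym_at_def)
qed

end

section \<open>Isomorphisms in homology from homotopy equivalences\<close>

text \<open>
  Chains, cycles and boundaries are additive subgroups of types that are groups.
\<close>

definition add_closed :: "'m::ab_group_add set \<Rightarrow> bool" where
  "add_closed Z \<longleftrightarrow> 0 \<in> Z \<and> (\<forall>x\<in>Z. \<forall>y\<in>Z. x - y \<in> Z)"

lemma add_closed_add: "add_closed Z \<Longrightarrow> x \<in> Z \<Longrightarrow> y \<in> Z \<Longrightarrow> x + y \<in> Z"
  unfolding add_closed_def by (metis add_diff_cancel_left' diff_0 diff_diff_eq2 diff_minus_eq_add)

lemma add_closed_minus: "add_closed Z \<Longrightarrow> x \<in> Z \<Longrightarrow> - x \<in> Z"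
  unfolding add_closed_def by (metis diff_0)

lemma comm_group_add_grp:
  assumes "add_closed Z"
  shows "comm_group (add_grp Z)"
proof (rule comm_groupI)
  fix x assume "x \<in> carrier (add_grp Z)"
  then show "\<exists>y\<in>carrier (add_grp Z). y \<otimes>\<^bsub>add_grp Z\<^esub> x = \<one>\<^bsub>add_grp Z\<^esub>"
    using assms by (intro bexI[of _ "- x"]) (auto simp: add_grp_def add_closed_minus)
qed (use assms in \<open>auto simp: add_grp_def add_closed_add ac_simps add_closed_def\<close>)

lemma normal_add_grp:
  assumes Z: "add_closed Z" and B: "add_closed B" and "B \<subseteq> Z"
  shows "B \<lhd> add_grp Z"
proof -
  interpret comm_group "add_grp Z" by (rule comm_group_add_grp[OF Z])
  have "subgroup B (add_grp Z)"
  proof (rule subgroupI)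
    fix x assume x: "x \<in> B"
    have "inv\<^bsub>add_grp Z\<^esub> x = - x"
      using x assms by (intro inv_equality) (auto simp: add_grp_def add_closed_minus)
    then show "inv\<^bsub>add_grp Z\<^esub> x \<in> B" using B x by (simp add: add_closed_minus)
  qed (use assms in \<open>auto simp: add_grp_def add_closed_add\<close>, auto simp: add_closed_def)
  then show ?thesis by (rule subgroup_imp_normal)
qed

lemma add_grp_coset: "B #>\<^bsub>add_grp Z\<^esub> x = (\<lambda>b. b + x) ` B"
  by (auto simp: r_coset_def add_grp_def)

lemma add_grp_coset_eq_iff:
  assumes "add_closed B"
  shows "B #>\<^bsub>add_grp Z\<^esub> x = B #>\<^bsub>add_grp Z\<^esub> y \<longleftrightarrow> x - y \<in> B"
proof
  assume eq: "B #>\<^bsub>add_grp Z\<^esub> x = B #>\<^bsub>add_grp Z\<^esub> y"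
  have "x \<in> B #>\<^bsub>add_grp Z\<^esub> x"
    unfolding add_grp_coset using assms by (intro image_eqI[of _ _ 0]) (auto simp: add_closed_def)
  then have "x \<in> B #>\<^bsub>add_grp Z\<^esub> y" by (simp only: eq)
  then obtain b where "b \<in> B" "x = b + y" unfolding add_grp_coset by blast
  then show "x - y \<in> B" by simp
next
  assume xy: "x - y \<in> B"
  show "B #>\<^bsub>add_grp Z\<^esub> x = B #>\<^bsub>add_grp Z\<^esub> y"
    unfolding add_grp_coset
  proof (intro equalityI image_subsetI)
    fix b assume b: "b \<in> B"
    have "b + (x - y) \<in> B" "b - (x - y) \<in> B"
      using assms b xy by (auto simp: add_closed_add, simp add: add_closed_def)
    then show "b + x \<in> (\<lambda>b. b + y) ` B"
      by (intro image_eqI[of _ _ "b + (x - y)"]) simp_all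
    show "b + y \<in> (\<lambda>b. b + x) ` B"
      using \<open>b - (x - y) \<in> B\<close> by (intro image_eqI[of _ _ "b - (x - y)"]) simp_all
  qed
qed

lemma add_closed_cycles:
  assumes "add_closed (C p)" "additive d"
  shows "add_closed (cycles C d p)"
  using assms by (auto simp: add_closed_def cycles_def additive.diff additive.zero)

lemma add_closed_boundaries:
  assumes "add_closed (C (Suc p))" "additive d"
  shows "add_closed (boundaries C d p)"
  unfolding add_closed_def boundaries_def
proof (intro conjI ballI)
  show "0 \<in> d ` C (Suc p)"
    using assms by (intro image_eqI[of _ _ 0]) (auto simp: additive.zero add_closed_def)
next
  fix x y assume "x \<in> d ` C (Suc p)" "y \<in> d ` C (Suc p)"
  then obtain a b where "a \<in> C (Suc p)" "b \<in> C (Suc p)" "x = d a" "y = d b" by auto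
  then show "x - y \<in> d ` C (Suc p)"
    using assms by (intro image_eqI[of _ _ "a - b"]) (auto simp: additive.diff add_closed_def)
qed

text \<open>
  The backward maps \<open>H\<close> are allowed to depend on the degree and to be known only on chains.  The
  map \<open>F\<close> is onto in homology because \<open>F H\<close> is the identity, and injective because a cycle \<open>x\<close> with
  \<open>F x\<close> a boundary differs by a boundary from \<open>H F x\<close>, which is itself a boundary.
\<close>

lemma induced_iso:
  fixes d :: "'l::ab_group_add \<Rightarrow> 'l" and d' :: "'m::ab_group_add \<Rightarrow> 'm"
  assumes C: "\<And>p. add_closed (C p)" and C': "\<And>p. add_closed (C' p)"
    and d: "additive d" and d': "additive d'" and F: "additive F"
    and dC: "\<And>x. x \<in> C (Suc p) \<Longrightarrow> d x \<in> C p \<and> d (d x) = 0"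
    and dC': "\<And>y. y \<in> C' (Suc p) \<Longrightarrow> d' y \<in> C' p \<and> d' (d' y) = 0"
    and FC: "\<And>q x. x \<in> C q \<Longrightarrow> F x \<in> C' q \<and> d' (F x) = F (d x)"
    and HC: "\<And>q y. y \<in> C' q \<Longrightarrow> H q y \<in> C q"
    and H_cycle: "\<And>y. y \<in> C' p \<Longrightarrow> d' y = 0 \<Longrightarrow> d (H p y) = 0"
    and H_boundary: "\<And>y. y \<in> C' (Suc p) \<Longrightarrow> d (H (Suc p) y) = H p (d' y)"
    and FH: "\<And>y. y \<in> C' p \<Longrightarrow> F (H p y) = y"
    and HF: "\<And>x. x \<in> C p \<Longrightarrow> d x = 0 \<Longrightarrow> x - H p (F x) \<in> d ` C (Suc p)"
  shows "induced C' d' p F \<in> iso (homology C d p) (homology C' d' p)"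
proof -
  let ?Z = "cycles C d p" and ?B = "boundaries C d p"
  let ?Z' = "cycles C' d' p" and ?B' = "boundaries C' d' p"
  have Z: "add_closed ?Z" and Z': "add_closed ?Z'"
    using C C' d d' by (auto intro: add_closed_cycles)
  have B: "add_closed ?B" and B': "add_closed ?B'"
    using C C' d d' by (auto intro: add_closed_boundaries)
  have BZ: "?B \<subseteq> ?Z" and BZ': "?B' \<subseteq> ?Z'"
    using dC dC' by (auto simp: boundaries_def cycles_def)
  interpret N: normal ?B "add_grp ?Z" by (rule normal_add_grp[OF Z B BZ])
  interpret N': normal ?B' "add_grp ?Z'" by (rule normal_add_grp[OF Z' B' BZ'])
  have car: "carrier (homology C d p) = (\<lambda>x. ?B #>\<^bsub>add_grp ?Z\<^esub> x) ` ?Z"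
    and car': "carrier (homology C' d' p) = (\<lambda>x. ?B' #>\<^bsub>add_grp ?Z'\<^esub> x) ` ?Z'"
    by (auto simp: homology_def FactGroup_def RCOSETS_def add_grp_def)
  have FZ: "F x \<in> ?Z'" if "x \<in> ?Z" for x
    using that FC[of x p] by (auto simp: cycles_def additive.zero[OF F])
  have FB: "F b \<in> ?B'" if b: "b \<in> ?B" for b
  proof -
    obtain x where "b = d x" "x \<in> C (Suc p)" using b by (auto simp: boundaries_def)
    then show ?thesis using FC[of x "Suc p"] by (auto simp: boundaries_def intro!: image_eqI[of _ _ "F x"])
  qed
  have ind: "induced C' d' p F (?B #>\<^bsub>add_grp ?Z\<^esub> x) = ?B' #>\<^bsub>add_grp ?Z'\<^esub> F x" for x
  proof -
    have "?B' #>\<^bsub>add_grp ?Z'\<^esub> F (b + x) = ?B' #>\<^bsub>add_grp ?Z'\<^esub> F x" if "b \<in> ?B" for b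
      using FB[OF that] by (simp add: add_grp_coset_eq_iff[OF B'] additive.add[OF F])
    moreover have "?B \<noteq> {}" using B by (auto simp: add_closed_def)
    ultimately show ?thesis by (simp add: induced_def add_grp_coset[where B = ?B and Z = ?Z])
  qed
  show ?thesis
  proof (rule isoI)
    show "induced C' d' p F \<in> hom (homology C d p) (homology C' d' p)"
    proof (rule homI)
      fix c assume "c \<in> carrier (homology C d p)"
      then show "induced C' d' p F c \<in> carrier (homology C' d' p)"
        unfolding car car' using FZ by (auto simp: ind)
    next
      fix c e assume "c \<in> carrier (homology C d p)" "e \<in> carrier (homology C d p)"
      then obtain x y where x: "x \<in> ?Z" "c = ?B #>\<^bsub>add_grp ?Z\<^esub> x"
        and y: "y \<in> ?Z" "e = ?B #>\<^bsub>add_grp ?Z\<^esub> y" unfolding car by auto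
      have "c \<otimes>\<^bsub>homology C d p\<^esub> e = ?B #>\<^bsub>add_grp ?Z\<^esub> (x + y)"
        using N.rcos_sum[of x y] x y by (simp add: homology_def FactGroup_def add_grp_def)
      moreover have "(?B' #>\<^bsub>add_grp ?Z'\<^esub> F x) \<otimes>\<^bsub>homology C' d' p\<^esub> (?B' #>\<^bsub>add_grp ?Z'\<^esub> F y)
          = ?B' #>\<^bsub>add_grp ?Z'\<^esub> (F x + F y)"
        using N'.rcos_sum[of "F x" "F y"] FZ[OF x(1)] FZ[OF y(1)]
        by (simp add: homology_def FactGroup_def add_grp_def)
      ultimately show "induced C' d' p F (c \<otimes>\<^bsub>homology C d p\<^esub> e) =
          induced C' d' p F c \<otimes>\<^bsub>homology C' d' p\<^esub> induced C' d' p F e"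
        by (simp add: ind x y additive.add[OF F])
    qed
    show "bij_betw (induced C' d' p F) (carrier (homology C d p)) (carrier (homology C' d' p))"
      unfolding bij_betw_def
    proof
      show "inj_on (induced C' d' p F) (carrier (homology C d p))"
      proof (rule inj_onI)
        fix c e assume "c \<in> carrier (homology C d p)" "e \<in> carrier (homology C d p)"
          and eq: "induced C' d' p F c = induced C' d' p F e"
        then obtain x y where x: "x \<in> ?Z" "c = ?B #>\<^bsub>add_grp ?Z\<^esub> x"
          and y: "y \<in> ?Z" "e = ?B #>\<^bsub>add_grp ?Z\<^esub> y" unfolding car by auto
        have xy: "x - y \<in> ?Z" using Z x y by (simp add: add_closed_def)
        have "F (x - y) \<in> ?B'"
          using eq by (simp add: x y ind add_grp_coset_eq_iff[OF B'] additive.diff[OF F])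
        then obtain z where z: "z \<in> C' (Suc p)" "F (x - y) = d' z" by (auto simp: boundaries_def)
        have "H p (F (x - y)) \<in> ?B"
          unfolding z(2) H_boundary[OF z(1), symmetric] using HC[OF z(1)] by (simp add: boundaries_def)
        moreover have "(x - y) - H p (F (x - y)) \<in> ?B"
          using HF[of "x - y"] xy by (auto simp: cycles_def boundaries_def)
        ultimately have "((x - y) - H p (F (x - y))) + H p (F (x - y)) \<in> ?B"
          by (intro add_closed_add[OF B])
        then show "c = e" by (simp add: x y add_grp_coset_eq_iff[OF B])
      qed
      show "induced C' d' p F ` carrier (homology C d p) = carrier (homology C' d' p)"
      proof (intro equalityI subsetI)
        fix c assume "c \<in> carrier (homology C' d' p)"
        then obtain y where y: "y \<in> ?Z'" "c = ?B' #>\<^bsub>add_grp ?Z'\<^esub> y" unfolding car' by auto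
        then have "H p y \<in> ?Z" using HC H_cycle by (auto simp: cycles_def)
        moreover have "F (H p y) = y" using y FH by (auto simp: cycles_def)
        ultimately show "c \<in> induced C' d' p F ` carrier (homology C d p)"
          unfolding car by (intro image_eqI[of _ _ "?B #>\<^bsub>add_grp ?Z\<^esub> H p y"]) (auto simp: ind y)
      qed (auto simp: car car' ind FZ)
    qed
  qed
qed

section \<open>The induced isomorphism in Hochschild homology\<close>

context env_twist
begin

text \<open>
  In degree zero the differential vanishes, so its value lies in the chains of the truncated degree
  \<open>p - 1 = 0\<close> as well; this avoids case distinctions on the degree.
\<close>

lemma free_on_bar_diff_single:
  assumes "ms \<in> mon_lists n p"
  shows "bar_diff (single ms 1) \<in> free_on (mon_lists n (p - 1)) (Env n)"
  using assms by (cases p) (auto simp: free_on_bar_gen)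

lemma free_on_koszul_diff_single:
  assumes "I \<in> incr n p"
  shows "koszul_diff (single I 1) \<in> free_on (incr n (p - 1)) (Env n)"
  using assms by (cases p) (auto simp: free_on_koszul_gen)

lemma Psi_eq_psi:
  "y \<in> chains (mon_lists n p) \<Longrightarrow> tensor_map G A (Psi n) y = tensor_map G A (psi n) y"
  by (erule tensor_map_cong) (simp add: Psi_single)

lemma bar_chains_eq: "bar_chains n g p = chains (mon_lists n p)"
  and koszul_chains_eq: "koszul_chains n g p = chains (incr n p)"
  by (simp_all add: bar_chains_def koszul_chains_def)

lemma bar_d_chains:
  "y \<in> chains (mon_lists n p) \<Longrightarrow> tensor_map G A bar_diff y \<in> chains (mon_lists n (p - 1))"
  by (erule tensor_map_chains) (rule free_on_bar_diff_single)

lemma koszul_d_chains: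
  "y \<in> chains (incr n p) \<Longrightarrow> tensor_map G A koszul_diff y \<in> chains (incr n (p - 1))"
  by (erule tensor_map_chains) (rule free_on_koszul_diff_single)

lemma psi_chains:
  "y \<in> chains (mon_lists n p) \<Longrightarrow> tensor_map G A (psi n) y \<in> chains (incr n p)"
  by (erule tensor_map_chains) (simp add: free_on_psi_gen)

lemma phi_chains:
  "y \<in> chains (incr n p) \<Longrightarrow> tensor_map G A (phi p) y \<in> chains (mon_lists n p)"
  by (erule tensor_map_chains) (simp add: free_on_phi_gen)

lemma psi_star_chain_map:
  assumes y: "y \<in> chains (mon_lists n p)"
  shows "tensor_map G A koszul_diff (tensor_map G A (psi n) y) = tensor_map G A (psi n) (tensor_map G A bar_diff y)"
proof -
  have "tensor_map G A koszul_diff (tensor_map G A (psi n) y) = tensor_map G A (\<lambda>X. koszul_diff (psi n X)) y"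
    unfolding koszul_diff_eq by (rule tensor_map_comp[OF y]) (simp, erule free_on_psi_gen)
  also have "\<dots> = tensor_map G A (\<lambda>X. psi n (bar_diff X)) y"
    using free_on_single[of _ "mon_lists n p", OF _ Env_1] by (intro tensor_map_cong[OF y] psi_chain_map)
  also have "\<dots> = tensor_map G A (psi n) (tensor_map G A bar_diff y)"
    by (rule tensor_map_comp[OF y, symmetric]) (rule free_on_bar_diff_single)
  finally show ?thesis .
qed

lemma phi_star_chain_map:
  assumes y: "y \<in> chains (incr n (Suc p))"
  shows "tensor_map G A bar_diff (tensor_map G A (phi (Suc p)) y) = tensor_map G A (phi p) (tensor_map G A koszul_diff y)"
proof -
  have "tensor_map G A bar_diff (tensor_map G A (phi (Suc p)) y) = tensor_map G A (\<lambda>X. bar_diff (phi (Suc p) X)) y"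
    unfolding bar_diff_eq by (rule tensor_map_comp[OF y]) (simp del: phi_gen.simps, erule free_on_phi_gen)
  also have "\<dots> = tensor_map G A (\<lambda>X. phi p (koszul_diff X)) y"
    using free_on_single[of _ "incr n (Suc p)", OF _ Env_1] by (intro tensor_map_cong[OF y] phi_chain_map)
  also have "\<dots> = tensor_map G A (phi p) (tensor_map G A koszul_diff y)"
    by (rule tensor_map_comp[OF y, symmetric]) (rule free_on_koszul_diff_single)
  finally show ?thesis .
qed

lemma bar_d_bar_d:
  assumes y: "y \<in> chains (mon_lists n p)"
  shows "tensor_map G A bar_diff (tensor_map G A bar_diff y) = 0"
proof -
  have "tensor_map G A bar_diff (tensor_map G A bar_diff y) = tensor_map G A (\<lambda>X. bar_diff (bar_diff X)) y"
    unfolding bar_diff_eq by (rule tensor_map_comp[OF y]) (erule free_on_bar_diff_single[unfolded bar_diff_eq])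
  then show ?thesis by (simp add: bar_diff_bar_diff tensor_map_0)
qed

lemma koszul_d_koszul_d:
  assumes y: "y \<in> chains (incr n (Suc p))"
  shows "tensor_map G A koszul_diff (tensor_map G A koszul_diff y) = 0"
proof -
  have "tensor_map G A koszul_diff (tensor_map G A koszul_diff y) = tensor_map G A (\<lambda>X. koszul_diff (koszul_diff X)) y"
    unfolding koszul_diff_eq by (rule tensor_map_comp[OF y]) (erule free_on_koszul_diff_single[unfolded koszul_diff_eq])
  also have "\<dots> = tensor_map G A (\<lambda>_. 0) y"
    by (rule tensor_map_cong[OF y]) (simp add: koszul_diff_koszul_gen)
  finally show ?thesis by (simp add: tensor_map_0)
qed

lemma psi_star_phi_star:
  assumes y: "y \<in> chains (incr n p)"
  shows "tensor_map G A (psi n) (tensor_map G A (phi p) y) = y"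
proof -
  have "tensor_map G A (psi n) (tensor_map G A (phi p) y) = tensor_map G A (\<lambda>X. psi n (phi p X)) y"
    by (rule tensor_map_comp[OF y]) (simp, erule free_on_phi_gen)
  also have "\<dots> = tensor_map G A (\<lambda>X. X) y"
    by (rule tensor_map_cong[OF y]) (simp add: psi_phi_gen)
  finally show ?thesis by (simp add: tensor_map_id[OF y])
qed

lemma phi_star_psi_star:
  assumes y: "y \<in> chains (mon_lists n p)"
  shows "y - tensor_map G A (phi p) (tensor_map G A (psi n) y) =
    tensor_map G A bar_diff (tensor_map G A (env_lin (htpy_gen n p)) y)
    + tensor_map G A (env_lin (htpy_gen n (p - 1))) (tensor_map G A bar_diff y)"
proof -
  have "y - tensor_map G A (phi p) (tensor_map G A (psi n) y) =
    tensor_map G A (\<lambda>X. X) y - tensor_map G A (\<lambda>X. phi p (psi n X)) y"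
    by (subst tensor_map_comp[OF y]) (simp, erule free_on_psi_gen, simp add: tensor_map_id[OF y])
  also have "\<dots> = tensor_map G A (\<lambda>X. X - phi p (psi n X)) y"
    by (rule tensor_map_diff[OF y, symmetric])
  also have "\<dots> = tensor_map G A (\<lambda>X. bar_diff (env_lin (htpy_gen n p) X) + env_lin (htpy_gen n (p - 1)) (bar_diff X)) y"
    by (rule tensor_map_cong[OF y]) (simp add: htpy_gen del: One_nat_def)
  also have "\<dots> = tensor_map G A (\<lambda>X. bar_diff (env_lin (htpy_gen n p) X)) y
      + tensor_map G A (\<lambda>X. env_lin (htpy_gen n (p - 1)) (bar_diff X)) y"
    by (rule tensor_map_add[OF y])
  also have "tensor_map G A (\<lambda>X. bar_diff (env_lin (htpy_gen n p) X)) y =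
      tensor_map G A bar_diff (tensor_map G A (env_lin (htpy_gen n p)) y)"
    unfolding bar_diff_eq by (rule tensor_map_comp[OF y, symmetric]) (simp, erule free_on_htpy_gen)
  also have "tensor_map G A (\<lambda>X. env_lin (htpy_gen n (p - 1)) (bar_diff X)) y =
      tensor_map G A (env_lin (htpy_gen n (p - 1))) (tensor_map G A bar_diff y)"
    by (rule tensor_map_comp[OF y, symmetric]) (rule free_on_bar_diff_single)
  finally show ?thesis .
qed

lemma Psi_star_is_chain_map:
  "is_chain_map (bar_chains n g) (tensor_map G A bar_diff) (koszul_chains n g) (tensor_map G A koszul_diff)
     (tensor_map G A (Psi n))"
  unfolding is_chain_map_def bar_chains_eq koszul_chains_eq
  by (auto simp: Psi_eq_psi psi_chains psi_star_chain_map tensor_map_cscale additive.add[OF additive_tensor_map]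
      dest: bar_d_chains simp: Psi_eq_psi[OF bar_d_chains])

lemma Psi_star_induced_iso:
  "induced (koszul_chains n g) (tensor_map G A koszul_diff) p (tensor_map G A (Psi n))
     \<in> iso (homology (bar_chains n g) (tensor_map G A bar_diff) p)
           (homology (koszul_chains n g) (tensor_map G A koszul_diff) p)"
proof (rule induced_iso[where H = "\<lambda>q. tensor_map G A (phi q)"])
  let ?d = "tensor_map G A bar_diff" and ?d' = "tensor_map G A koszul_diff"
  show "add_closed (bar_chains n g q)" "add_closed (koszul_chains n g q)" for q
    by (simp_all add: add_closed_def bar_chains_eq koszul_chains_eq add_closed_chains)
  show "additive ?d" "additive ?d'" "additive (tensor_map G A (Psi n))"
    by (rule additive_tensor_map)+
  show "?d x \<in> bar_chains n g p \<and> ?d (?d x) = 0" if "x \<in> bar_chains n g (Suc p)" for x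
    using that bar_d_chains[of x "Suc p"] by (simp add: bar_chains_eq bar_d_bar_d)
  show "?d' y \<in> koszul_chains n g p \<and> ?d' (?d' y) = 0" if "y \<in> koszul_chains n g (Suc p)" for y
    using that koszul_d_chains[of y "Suc p"] by (simp add: koszul_chains_eq koszul_d_koszul_d)
  show "tensor_map G A (Psi n) x \<in> koszul_chains n g q \<and>
      ?d' (tensor_map G A (Psi n) x) = tensor_map G A (Psi n) (?d x)" if "x \<in> bar_chains n g q" for q x
    using Psi_star_is_chain_map that by (simp add: is_chain_map_def)
  show phi: "tensor_map G A (phi q) y \<in> bar_chains n g q" if "y \<in> koszul_chains n g q" for q y
    using that by (simp add: phi_chains bar_chains_eq koszul_chains_eq)
  show "?d (tensor_map G A (phi p) y) = 0" if y: "y \<in> koszul_chains n g p" "?d' y = 0" for y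
  proof (cases p)
    case 0
    have "?d (tensor_map G A (phi p) y) = tensor_map G A (\<lambda>_. 0) (tensor_map G A (phi p) y)"
      using phi[OF y(1)] by (intro tensor_map_cong) (auto simp: bar_chains_eq 0)
    then show ?thesis by (simp add: tensor_map_0)
  next
    case (Suc q)
    then show ?thesis
      using y phi_star_chain_map[of y q] by (simp add: koszul_chains_eq additive.zero[OF additive_tensor_map] del: phi_gen.simps)
  qed
  show "?d (tensor_map G A (phi (Suc p)) y) = tensor_map G A (phi p) (?d' y)"
    if "y \<in> koszul_chains n g (Suc p)" for y
    using that unfolding koszul_chains_eq by (rule phi_star_chain_map)
  show "tensor_map G A (Psi n) (tensor_map G A (phi p) y) = y" if "y \<in> koszul_chains n g p" for y
    using that psi_star_phi_star[of y p] by (simp add: koszul_chains_eq Psi_eq_psi[OF phi_chains])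
  show "x - tensor_map G A (phi p) (tensor_map G A (Psi n) x) \<in> ?d ` bar_chains n g (Suc p)"
    if x: "x \<in> bar_chains n g p" "?d x = 0" for x
  proof -
    have c: "x \<in> chains (mon_lists n p)" using x by (simp add: bar_chains_eq)
    have "tensor_map G A (env_lin (htpy_gen n p)) x \<in> chains (mon_lists n (Suc p))"
      by (rule tensor_map_chains[OF c]) (simp add: free_on_htpy_gen)
    moreover have "x - tensor_map G A (phi p) (tensor_map G A (Psi n) x) =
        ?d (tensor_map G A (env_lin (htpy_gen n p)) x)"
      using phi_star_psi_star[OF c] x(2) by (simp add: Psi_eq_psi[OF c] additive.zero[OF additive_tensor_map])
    ultimately show ?thesis by (simp add: bar_chains_eq)
  qed
qed

end

section \<open>Quantum partial derivatives\<close>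

lemma additive_compose_sum: "(\<And>a. additive (f a)) \<Longrightarrow> additive (\<lambda>y. \<Sum>a\<in>S. f a y)"
  by (simp add: additive_def sum.distrib)

lemma cst_mult: "cst (c * d) = cst c * cst d"
  by (simp add: cst_def mult_single)

lemma cst_1 [simp]: "cst 1 = 1" and cst_0 [simp]: "cst 0 = 0"
  by (simp_all add: cst_def)

lemma cst_add: "cst (c + d) = cst c + cst d"
  by (simp add: cst_def single_add)

lemma cst_single: "cst c * single \<alpha> d = single \<alpha> (c * d)"
  by (simp add: cst_def mult_single)

lemma var_power: "var l ^ k = single (single l k) 1"
  by (induction k) (auto simp: var_def mult_single single_add[symmetric])

lemma prod_var: "\<alpha> \<in> mons n \<Longrightarrow> (\<Prod>l=1..n. var l ^ lookup \<alpha> l) = single \<alpha> 1"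
  unfolding var_power by (subst prod_single) (simp, subst mons_expand, simp_all)

lemma hom_prod:
  fixes \<eta> :: "'r::comm_ring_1 \<Rightarrow> 's::comm_ring_1"
  assumes "\<And>a b. \<eta> (a * b) = \<eta> a * \<eta> b" "\<eta> 1 = 1"
  shows "\<eta> (prod f S) = (\<Prod>a\<in>S. \<eta> (f a))"
  using assms by (induction S rule: infinite_finite_induct) auto

lemma hom_power:
  fixes \<eta> :: "'r::comm_ring_1 \<Rightarrow> 's::comm_ring_1"
  assumes "\<And>a b. \<eta> (a * b) = \<eta> a * \<eta> b" "\<eta> 1 = 1"
  shows "\<eta> (a ^ k) = \<eta> a ^ k"
  using assms by (induction k) auto

lemma hom_divdiff_mon:
  fixes \<eta> :: "'r::comm_ring_1 \<Rightarrow> 's::comm_ring_1"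
  assumes "additive \<eta>" "\<And>a b. \<eta> (a * b) = \<eta> a * \<eta> b" "\<eta> 1 = 1"
  shows "\<eta> (divdiff_mon x y n i \<alpha>) = divdiff_mon (\<lambda>l. \<eta> (x l)) (\<lambda>l. \<eta> (y l)) n i \<alpha>"
  by (simp add: divdiff_mon_def assms(2) additive.sum[OF assms(1)]
      hom_prod[of \<eta>, OF assms(2,3)] hom_power[of \<eta>, OF assms(2,3)])

lemma divdiff_mon_cong:
  assumes "i \<in> {1..n}" "\<And>l. l \<in> {i..n} \<Longrightarrow> x l = x' l" "\<And>l. l \<in> {1..i} \<Longrightarrow> y l = y' l"
  shows "divdiff_mon x y n i \<alpha> = divdiff_mon x' y' n i \<alpha>"
  using assms by (simp add: divdiff_mon_def)

text \<open>
  The algebra endomorphism that is diagonal in the basis, with eigenvalues \<open>e\<close>.  It describes the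
  action of \<open>g\<close>, of each \<open>s\<^sub>i\<close> and of the products \<open>s\<^sub>1 \<dots> s\<^sub>i\<^sub>-\<^sub>1\<close>.
\<close>

definition scale_vars :: "nat \<Rightarrow> (nat \<Rightarrow> complex) \<Rightarrow> pol \<Rightarrow> pol" where
  "scale_vars n e f = (\<Sum>\<alpha>\<in>keys f. cst (lookup f \<alpha>) * (\<Prod>l=1..n. (cst (e l) * var l) ^ lookup \<alpha> l))"

lemma additive_scale_vars: "additive (scale_vars n e)"
  unfolding scale_vars_def[abs_def]
  by (rule additive_sum_keys) (unfold_locales, simp add: cst_add distrib_right)

lemma scale_vars_single:
  "scale_vars n e (single \<alpha> c) = cst c * (\<Prod>l=1..n. (cst (e l) * var l) ^ lookup \<alpha> l)"
  unfolding scale_vars_def by (subst sum_keys_single) auto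

lemma scale_vars_one [simp]: "scale_vars n e 1 = 1"
  using scale_vars_single[of n e 0 1] by simp

lemma scale_vars_mult: "scale_vars n e (a * b) = scale_vars n e a * scale_vars n e b"
proof (rule additive_ext[where F = "\<lambda>a. scale_vars n e (a * b)" and H = "\<lambda>a. scale_vars n e a * scale_vars n e b"])
  fix \<alpha>
  let ?c = "lookup a \<alpha>"
  show "scale_vars n e (single \<alpha> ?c * b) = scale_vars n e (single \<alpha> ?c) * scale_vars n e b"
  proof (rule additive_ext[where F = "\<lambda>b. scale_vars n e (single \<alpha> ?c * b)"
        and H = "\<lambda>b. scale_vars n e (single \<alpha> ?c) * scale_vars n e b"])
    fix \<beta>
    show "scale_vars n e (single \<alpha> ?c * single \<beta> (lookup b \<beta>)) =
      scale_vars n e (single \<alpha> ?c) * scale_vars n e (single \<beta> (lookup b \<beta>))"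
      by (simp add: mult_single scale_vars_single cst_mult lookup_add power_add prod.distrib)
  qed (unfold_locales, simp_all add: distrib_left additive.add[OF additive_scale_vars])
qed (unfold_locales, simp_all add: distrib_right additive.add[OF additive_scale_vars])

lemma scale_vars_cst [simp]: "scale_vars n e (cst c) = cst c"
  by (simp add: cst_def[of c] scale_vars_single)

lemma scale_vars_var: "i \<in> {1..n} \<Longrightarrow> scale_vars n e (var i) = cst (e i) * var i"
proof -
  assume i: "i \<in> {1..n}"
  have "(\<Prod>l=1..n. (cst (e l) * var l) ^ lookup (single i (1::nat)) l) =
      (\<Prod>l=1..n. if l = i then cst (e l) * var l else 1)"
    by (intro prod.cong refl) (auto simp: lookup_single)
  then show ?thesis using i by (simp add: var_def[of i] scale_vars_single)
qed

lemma scale_vars_Sym: "scale_vars n e f \<in> Sym n"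
  unfolding scale_vars_def
  by (intro Sym_sum Sym_mult Sym_cst Sym_prod Sym_power Sym_var)

lemma scale_vars_id:
  assumes "f \<in> Sym n"
  shows "scale_vars n (\<lambda>_. 1) f = f"
proof (rule additive_ext[where F = "scale_vars n (\<lambda>_. 1)" and H = "\<lambda>f. f"])
  fix \<alpha> assume "\<alpha> \<in> keys f"
  then have "\<alpha> \<in> mons n" using assms by (auto simp: Sym_def)
  then show "scale_vars n (\<lambda>_. 1) (single \<alpha> (lookup f \<alpha>)) = single \<alpha> (lookup f \<alpha>)"
    by (simp add: scale_vars_single prod_var cst_single del: One_nat_def)
qed (rule additive_scale_vars, simp add: additive_def)

text \<open>
  The operator \<open>\<partial>\<^sub>i\<close> for the eigenvalue \<open>q\<close>, without division: \<open>f\<close> and \<open>s\<^sub>i f\<close> are the mixed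
  values of \<open>f\<close> before and after the replacement of \<open>v\<^sub>i\<close> by \<open>q v\<^sub>i\<close>, so the quotient of their
  difference is a divided difference.
\<close>

definition qdiff :: "nat \<Rightarrow> complex \<Rightarrow> nat \<Rightarrow> pol \<Rightarrow> pol" where
  "qdiff n q i f = (\<Sum>\<alpha>\<in>keys f. cst (lookup f \<alpha>) *
     divdiff_mon var (\<lambda>l. if l = i then cst q * var l else var l) n i \<alpha>)"

lemma additive_qdiff: "additive (qdiff n q i)"
  unfolding qdiff_def[abs_def]
  by (rule additive_sum_keys) (unfold_locales, simp add: cst_add distrib_right)

lemma qdiff_single:
  "qdiff n q i (single \<alpha> c) = cst c * divdiff_mon var (\<lambda>l. if l = i then cst q * var l else var l) n i \<alpha>"
  unfolding qdiff_def by (subst sum_keys_single) auto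

lemma qdiff_mult:
  assumes i: "i \<in> {1..n}" and f: "f \<in> Sym n"
  shows "qdiff n q i f * (var i - cst q * var i) = f - scale_vars n (\<lambda>l. if l = i then q else 1) f"
proof (rule additive_ext[where F = "\<lambda>f. qdiff n q i f * (var i - cst q * var i)"
      and H = "\<lambda>f. f - scale_vars n (\<lambda>l. if l = i then q else 1) f"])
  fix \<alpha> assume "\<alpha> \<in> keys f"
  then have \<alpha>: "\<alpha> \<in> mons n" using f by (auto simp: Sym_def)
  let ?y = "\<lambda>l. if l = i then cst q * var l else var l"
  have split: "{1..n} = {1..<i} \<union> {i} \<union> {i<..n}" using i by auto
  have prod_split: "(\<Prod>l=1..n. h l) = (\<Prod>l\<in>{1..<i}. h l) * h i * (\<Prod>l\<in>{i<..n}. h l)" for h :: "nat \<Rightarrow> pol"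
    unfolding split by (subst prod.union_disjoint, auto)+
  have "mixed_mon var ?y n (i - 1) \<alpha> = single \<alpha> 1"
    unfolding mixed_mon_pred[OF i] prod_var[OF \<alpha>, symmetric] prod_split by simp
  moreover have "mixed_mon var ?y n i \<alpha> = (\<Prod>l=1..n. (cst (if l = i then q else 1) * var l) ^ lookup \<alpha> l)"
    unfolding mixed_mon_self[OF i] prod_split by simp
  ultimately have "divdiff_mon var ?y n i \<alpha> * (var i - cst q * var i) =
      single \<alpha> 1 - (\<Prod>l=1..n. (cst (if l = i then q else 1) * var l) ^ lookup \<alpha> l)"
    using divdiff_mon_mult[OF i, of var ?y \<alpha>] by simp
  then show "qdiff n q i (single \<alpha> (lookup f \<alpha>)) * (var i - cst q * var i) =
      single \<alpha> (lookup f \<alpha>) - scale_vars n (\<lambda>l. if l = i then q else 1) (single \<alpha> (lookup f \<alpha>))"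
    unfolding qdiff_single scale_vars_single mult.assoc
    by (simp only: if_P right_diff_distrib cst_single mult_1_right)
qed (unfold_locales, simp_all add: additive.add[OF additive_qdiff] additive.add[OF additive_scale_vars] distrib_right)

text \<open>
  For \<open>q = 1\<close> the two points coincide and the geometric sum of \<open>k\<close> equal terms is the derivative of
  the \<open>k\<close>-th power.
\<close>

lemma qdiff_1_eq_partial:
  assumes i: "i \<in> {1..n}" and f: "f \<in> Sym n"
  shows "qdiff n 1 i f = partial i f"
  unfolding qdiff_def partial_def
proof (rule sum.cong[OF refl])
  fix \<alpha> assume "\<alpha> \<in> keys f"
  then have \<alpha>: "\<alpha> \<in> mons n" using f by (auto simp: Sym_def)
  let ?\<beta> = "\<alpha> - single i 1" and ?k = "lookup \<alpha> i"
  have split: "{1..n} = {1..<i} \<union> {i} \<union> {i<..n}" using i by auto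
  have prod_split: "(\<Prod>l=1..n. h l) = (\<Prod>l\<in>{1..<i}. h l) * h i * (\<Prod>l\<in>{i<..n}. h l)" for h :: "nat \<Rightarrow> pol"
    unfolding split by (subst prod.union_disjoint, auto)+
  have \<beta>: "?\<beta> \<in> mons n" using \<alpha> by (auto simp: mons_def in_keys_iff lookup_minus)
  have "(\<Sum>a<?k. var i ^ a * var i ^ (?k - 1 - a)) = (\<Sum>a<?k. var i ^ (?k - 1))"
    by (intro sum.cong refl) (auto simp flip: power_add)
  then have "divdiff_mon var var n i \<alpha> = of_nat ?k *
      ((\<Prod>l\<in>{1..<i}. var l ^ lookup ?\<beta> l) * var i ^ lookup ?\<beta> i * (\<Prod>l\<in>{i<..n}. var l ^ lookup ?\<beta> l))"
    by (simp add: divdiff_mon_def lookup_minus lookup_single ac_simps)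
  also have "\<dots> = of_nat ?k * single ?\<beta> 1"
    unfolding prod_var[OF \<beta>, symmetric] prod_split ..
  also have "of_nat ?k = cst (of_nat ?k)" by (simp add: cst_def)
  finally have "divdiff_mon var var n i \<alpha> = single ?\<beta> (of_nat ?k)" by (simp add: cst_single)
  moreover have "divdiff_mon var (\<lambda>l. if l = i then cst 1 * var l else var l) n i \<alpha> = divdiff_mon var var n i \<alpha>"
    by (rule divdiff_mon_cong[OF i]) auto
  ultimately show "cst (lookup f \<alpha>) * divdiff_mon var (\<lambda>l. if l = i then cst 1 * var l else var l) n i \<alpha> =
      single ?\<beta> (of_nat ?k * lookup f \<alpha>)"
    by (simp add: cst_single mult.commute)
qed

text \<open>
  Scaling the variables below \<open>i\<close> changes the points of the divided difference that defines \<open>\<partial>\<^sub>i\<close>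
  into the points \<open>v\<^sub>l\<close> and \<open>\<epsilon>\<^sub>l v\<^sub>l\<close> by which the two sides of the enveloping algebra act.
\<close>

lemma scale_vars_qdiff:
  assumes i: "i \<in> {1..n}"
  shows "scale_vars n (\<lambda>l. if l < i then e l else 1) (qdiff n (e i) i f) =
    (\<Sum>\<alpha>\<in>keys f. cst (lookup f \<alpha>) * divdiff_mon var (\<lambda>l. cst (e l) * var l) n i \<alpha>)"
proof -
  let ?P = "scale_vars n (\<lambda>l. if l < i then e l else 1)"
  have "?P (divdiff_mon var (\<lambda>l. if l = i then cst (e i) * var l else var l) n i \<alpha>) =
      divdiff_mon var (\<lambda>l. cst (e l) * var l) n i \<alpha>" for \<alpha>
    unfolding hom_divdiff_mon[of ?P, OF additive_scale_vars scale_vars_mult scale_vars_one]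
    using i by (intro divdiff_mon_cong[OF i]) (auto simp: scale_vars_var scale_vars_mult)
  then show ?thesis
    by (simp add: qdiff_def additive.sum[OF additive_scale_vars] scale_vars_mult)
qed

section \<open>The twisted action in an eigenbasis\<close>

locale eigen_module = CG_module G scale \<rho>
  for G :: "('g, 'b) monoid_scheme" (structure)
    and scale :: "complex \<Rightarrow> 'v::ab_group_add \<Rightarrow> 'v" and \<rho> :: "'g \<Rightarrow> 'v \<Rightarrow> 'v" +
  fixes g :: 'g and n :: nat and v :: "nat \<Rightarrow> 'v" and \<epsilon> :: "nat \<Rightarrow> complex"
  assumes g_carrier: "g \<in> carrier G"
    and eigen: "eigenbasis scale (\<rho> g) n v \<epsilon>"
begin

lemma coord_scale_basis:
  assumes "i \<in> {1..n}" "j \<in> {1..n}"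
  shows "coord scale n v (scale c (v i)) j = (if j = i then c else 0)"
proof -
  have "independent (v ` {1..n})" "inj_on v {1..n}" using eigen by (auto simp: eigenbasis_def)
  then show ?thesis
    using assms by (auto simp: coord_def representation_scale span_base representation_basis inj_on_eq_iff)
qed

lemma incl_scale_basis:
  assumes "i \<in> {1..n}"
  shows "incl scale n v (scale c (v i)) = cst c * var i"
proof -
  have "incl scale n v (scale c (v i)) = (\<Sum>j=1..n. if j = i then cst c * var i else 0)"
    unfolding incl_def using assms by (intro sum.cong refl) (simp add: coord_scale_basis)
  then show ?thesis using assms by simp
qed

lemma incl_basis: "i \<in> {1..n} \<Longrightarrow> incl scale n v (v i) = var i"
  using incl_scale_basis[of i 1] by simp

lemma sym_ext_diag:
  assumes "\<And>i. i \<in> {1..n} \<Longrightarrow> T (v i) = scale (e i) (v i)"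
  shows "sym_ext scale n v T f = scale_vars n e f"
  unfolding sym_ext_def scale_vars_def
  by (intro sum.cong prod.cong arg_cong2[where f = "(*)"] refl) (simp add: assms incl_scale_basis)

lemma s_map_scale_basis:
  assumes "l \<in> {1..n}"
  shows "s_map scale n v \<epsilon> i (scale c (v l)) = scale (c * (if l = i then \<epsilon> l else 1)) (v l)"
proof -
  have "s_map scale n v \<epsilon> i (scale c (v l)) =
      (\<Sum>j=1..n. if j = l then scale c (if j = i then scale (\<epsilon> i) (v i) else v j) else 0)"
    unfolding s_map_def using assms by (intro sum.cong refl) (simp add: coord_scale_basis)
  then show ?thesis using assms by simp
qed

lemma s_prefix_basis:
  assumes "l \<in> {1..n}"
  shows "s_prefix scale n v \<epsilon> i (v l) = scale (if l < i then \<epsilon> l else 1) (v l)"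
proof -
  have "foldr (\<lambda>j T. s_map scale n v \<epsilon> j \<circ> T) js id (v l) = scale (if l \<in> set js then \<epsilon> l else 1) (v l)"
    if "distinct js" for js
    using that by (induction js) (auto simp: s_map_scale_basis[OF assms])
  from this[of "[1..<i]"] show ?thesis using assms by (simp add: s_prefix_def)
qed

lemma sym_ext_s_prefix:
  "sym_ext scale n v (s_prefix scale n v \<epsilon> i) f = scale_vars n (\<lambda>l. if l < i then \<epsilon> l else 1) f"
  by (rule sym_ext_diag) (rule s_prefix_basis)

text \<open>
  For \<open>\<epsilon>\<^sub>i \<noteq> 1\<close> the divisor \<open>(1 - \<epsilon>\<^sub>i) v\<^sub>i\<close> is not zero, and polynomials form an integral domain; so
  the quotient is unique.
\<close>

lemma qpartial_eq:
  assumes i: "i \<in> {1..n}" and f: "f \<in> Sym n"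
  shows "qpartial scale n v \<epsilon> i f = qdiff n (\<epsilon> i) i f"
proof (cases "\<epsilon> i = 1")
  case True
  then show ?thesis by (simp add: qpartial_def qdiff_1_eq_partial[OF i f])
next
  case False
  have s: "s_map scale n v \<epsilon> i (v l) = scale (if l = i then \<epsilon> i else 1) (v l)" if "l \<in> {1..n}" for l
    using s_map_scale_basis[OF that, of i 1] by auto
  have diff: "incl scale n v (v i) - incl scale n v (s_map scale n v \<epsilon> i (v i)) = var i - cst (\<epsilon> i) * var i"
    using i by (simp add: s incl_basis incl_scale_basis)
  have sym: "sym_ext scale n v (s_map scale n v \<epsilon> i) f = scale_vars n (\<lambda>l. if l = i then \<epsilon> i else 1) f"
    by (rule sym_ext_diag) (rule s)
  have "var i - cst (\<epsilon> i) * var i = single (single i 1) (1 - \<epsilon> i)"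
    by (simp add: var_def cst_single single_diff)
  then have "var i - cst (\<epsilon> i) * var i \<noteq> 0"
    using False by (metis eq_iff_diff_eq_0 lookup_single_eq lookup_zero)
  then have "q = qdiff n (\<epsilon> i) i f" if "q * (var i - cst (\<epsilon> i) * var i) = qdiff n (\<epsilon> i) i f * (var i - cst (\<epsilon> i) * var i)" for q
    using that by (simp only: mult_cancel_right) simp
  then have "(THE q. q * (var i - cst (\<epsilon> i) * var i) = f - scale_vars n (\<lambda>l. if l = i then \<epsilon> i else 1) f)
      = qdiff n (\<epsilon> i) i f"
    unfolding qdiff_mult[OF i f, of "\<epsilon> i", symmetric] by (intro the_equality) auto
  then show ?thesis using False by (simp add: qpartial_def Let_def diff sym)
qed

text \<open>
  The left factor acts by multiplication, and the right one after passing \<open>g\<close>, which scales its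
  variables: \<open>f g b = f (b scaled by \<epsilon>) g\<close>.
\<close>

definition \<theta> :: "env \<Rightarrow> pol" where
  "\<theta> e = (\<Sum>p\<in>keys e. single (fst p) (lookup e p) * scale_vars n \<epsilon> (single (snd p) 1))"

lemma additive_\<theta>: "additive \<theta>"
  unfolding \<theta>_def[abs_def]
  by (rule additive_sum_keys) (unfold_locales, simp add: single_add distrib_right)

lemma \<theta>_single: "\<theta> (single (\<alpha>, \<beta>) c) = single \<alpha> c * scale_vars n \<epsilon> (single \<beta> 1)"
  unfolding \<theta>_def by (subst sum_keys_single) auto

lemma \<theta>_mult: "\<theta> (a * b) = \<theta> a * \<theta> b"
proof (rule additive_ext[where F = "\<lambda>a. \<theta> (a * b)" and H = "\<lambda>a. \<theta> a * \<theta> b"])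
  fix p :: "mon \<times> mon"
  obtain \<alpha> \<beta> where p: "p = (\<alpha>, \<beta>)" by (cases p)
  let ?a = "single p (lookup a p)"
  show "\<theta> (?a * b) = \<theta> ?a * \<theta> b"
  proof (rule additive_ext[where F = "\<lambda>b. \<theta> (?a * b)" and H = "\<lambda>b. \<theta> ?a * \<theta> b"])
    fix q :: "mon \<times> mon"
    obtain \<gamma> \<delta> where q: "q = (\<gamma>, \<delta>)" by (cases q)
    have "scale_vars n \<epsilon> (single (\<beta> + \<delta>) 1) = scale_vars n \<epsilon> (single \<beta> 1) * scale_vars n \<epsilon> (single \<delta> 1)"
      by (simp add: mult_single flip: scale_vars_mult)
    moreover have "single (\<alpha> + \<gamma>) (c * d) = single \<alpha> c * (single \<gamma> d :: pol)" for c d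
      by (simp add: mult_single)
    ultimately show "\<theta> (?a * single q (lookup b q)) = \<theta> ?a * \<theta> (single q (lookup b q))"
      by (simp add: p q mult_single[of "(\<alpha>, \<beta>)"] \<theta>_single ac_simps)
  qed (unfold_locales, simp_all add: distrib_left additive.add[OF additive_\<theta>])
qed (unfold_locales, simp_all add: distrib_right additive.add[OF additive_\<theta>])

lemma \<theta>_one: "\<theta> 1 = 1"
  using \<theta>_single[of 0 0 1] by (simp flip: zero_prod_def)

lemma \<theta>_xvar: "\<theta> (xvar l) = var l"
  by (simp add: xvar_def \<theta>_single var_def)

lemma \<theta>_yvar: "l \<in> {1..n} \<Longrightarrow> \<theta> (yvar l) = cst (\<epsilon> l) * var l"
  using scale_vars_var[of l n \<epsilon>] by (simp add: yvar_def \<theta>_single var_def[of l])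

lemma \<theta>_divdiff:
  assumes "i \<in> {1..n}"
  shows "\<theta> (divdiff n i m) = divdiff_mon var (\<lambda>l. cst (\<epsilon> l) * var l) n i m"
  unfolding hom_divdiff_mon[of \<theta>, OF additive_\<theta> \<theta>_mult \<theta>_one]
  using assms by (intro divdiff_mon_cong) (auto simp: \<theta>_xvar \<theta>_yvar)

abbreviation Act :: "'g \<Rightarrow> pol \<Rightarrow> pol" where
  "Act \<equiv> \<lambda>h. sym_ext scale n v (\<rho> h)"

lemma additive_Act: "additive (Act h)"
  unfolding sym_ext_def[abs_def]
  by (rule additive_sum_keys) (unfold_locales, simp add: cst_add distrib_right)

lemma additive_skew_mult_left: "additive (\<lambda>x. skew_mult G Act x y)"
  unfolding skew_mult_def
  by (rule additive_sum_keys) (unfold_locales, simp add: distrib_right single_add sum.distrib)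

lemma additive_skew_mult_right: "additive (\<lambda>y. skew_mult G Act x y)"
  unfolding skew_mult_def
  by (rule additive_compose_sum, rule additive_sum_keys)
    (unfold_locales, simp add: additive.add[OF additive_Act] distrib_left single_add)

lemma skew_mult_single:
  "skew_mult G Act (single h a) (single k b) = single (h \<otimes> k) (a * Act h b)"
  unfolding skew_mult_def
  by (subst sum_keys_single, simp, subst sum_keys_single) (simp_all add: additive.zero[OF additive_Act])

lemma env_act_single:
  assumes f: "f \<in> Sym n"
  shows "env_act G Act e (single g f) = single g (\<theta> e * f)"
proof -
  have act_g: "Act g h = scale_vars n \<epsilon> h" for h
    using eigen by (intro sym_ext_diag) (auto simp: eigenbasis_def)
  have act_one: "Act \<one> h = h" if "h \<in> Sym n" for h
    using sym_ext_diag[of "\<rho> \<one>" "\<lambda>_. 1" h] scale_vars_id[OF that] by (simp add: action_one)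
  have "skew_mult G Act (single \<one> (single \<alpha> c)) (skew_mult G Act (single g f) (single \<one> (single \<beta> 1)))
      = single g ((single \<alpha> c * scale_vars n \<epsilon> (single \<beta> 1)) * f)" for \<alpha> \<beta> c
    using g_carrier by (simp add: skew_mult_single act_g act_one Sym_mult f scale_vars_Sym ac_simps)
  then show ?thesis
    by (simp add: env_act_def \<theta>_def case_prod_unfold sum_single_fixed sum_distrib_right)
qed

sublocale env_twist G Act g n \<theta>
proof
  fix e x y
  have "additive (\<lambda>m. skew_mult G Act a (skew_mult G Act m b))" for a b
    by (rule additive_comp[OF additive_skew_mult_right additive_skew_mult_left])
  then show "env_act G Act e (x + y) = env_act G Act e x + env_act G Act e y"
    by (simp add: env_act_def case_prod_unfold additive_def sum.distrib)
next
  fix e assume "e \<in> Env n"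
  then show "\<theta> e \<in> Sym n"
    unfolding \<theta>_def by (intro Sym_sum Sym_mult Sym_single scale_vars_Sym) (auto simp: Env_def)
qed (simp_all add: env_act_single additive.add[OF additive_\<theta>] \<theta>_mult \<theta>_one)

end

section \<open>The formula at the chain level\<close>

lemma keys_tensor_list:
  "set fs \<subseteq> Sym n \<Longrightarrow> keys (tensor_list fs) \<subseteq> mon_lists n (length fs)"
proof (induction fs)
  case (Cons f fs)
  show ?case
  proof
    fix ks assume "ks \<in> keys (tensor_list (f # fs))"
    then obtain \<alpha> ms where "\<alpha> \<in> keys f" "ms \<in> keys (tensor_list fs)" "ks = \<alpha> # ms"
      unfolding tensor_list.simps by (auto dest!: subsetD[OF keys_sum] split: if_splits)
    then show "ks \<in> mon_lists n (length (f # fs))"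
      using Cons by (auto simp: mon_lists_Cons Sym_def)
  qed
qed simp

text \<open>
  Multilinearity: a product of functions of the single tensor factors is determined by its values on
  monomials.
\<close>

lemma tensor_list_expand:
  fixes d :: "nat \<Rightarrow> mon \<Rightarrow> pol"
  assumes "length I = length fs"
  shows "(\<Sum>ms\<in>keys (tensor_list fs). cst (lookup (tensor_list fs) ms) * prod_list (map2 d I ms)) =
    prod_list (map2 (\<lambda>i f. \<Sum>\<alpha>\<in>keys f. cst (lookup f \<alpha>) * d i \<alpha>) I fs)"
  using assms
proof (induction fs arbitrary: I)
  case Nil
  then show ?case by simp
next
  case (Cons f fs)
  obtain i J where I: "I = i # J" using Cons.prems by (cases I) auto
  define L where "L x = (\<Sum>ms\<in>keys x. cst (lookup x ms) * prod_list (map2 d I ms))" for x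
  have L: "additive L"
    unfolding L_def[abs_def] by (rule additive_sum_keys) (unfold_locales, simp add: cst_add distrib_right)
  have L_single: "L (single (\<alpha> # ms) (a * c)) = (cst a * d i \<alpha>) * (cst c * prod_list (map2 d J ms))" for \<alpha> ms a c
    unfolding L_def by (subst sum_keys_single) (simp_all add: I cst_mult ac_simps)
  have "L (tensor_list (f # fs)) = (\<Sum>\<alpha>\<in>keys f. cst (lookup f \<alpha>) * d i \<alpha>) *
      (\<Sum>ms\<in>keys (tensor_list fs). cst (lookup (tensor_list fs) ms) * prod_list (map2 d J ms))"
    by (simp add: additive.sum[OF L] L_single sum_product)
  also have "(\<Sum>ms\<in>keys (tensor_list fs). cst (lookup (tensor_list fs) ms) * prod_list (map2 d J ms)) =
      prod_list (map2 (\<lambda>i f. \<Sum>\<alpha>\<in>keys f. cst (lookup f \<alpha>) * d i \<alpha>) J fs)"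
    using Cons.prems by (intro Cons.IH) (simp add: I)
  finally show ?case by (simp add: L_def I)
qed

lemma prod_list_map2_upt:
  fixes h :: "'a \<Rightarrow> 'c \<Rightarrow> 'd::comm_monoid_mult"
  assumes "length I = p"
  shows "prod_list (map2 h I (map f [1..<Suc p])) = (\<Prod>k=1..p. h (I ! (k - 1)) (f k))"
proof -
  have "map2 h I (map f [1..<Suc p]) = map (\<lambda>k. h (I ! (k - 1)) (f k)) [1..<Suc p]"
    using assms by (intro nth_equalityI) (auto simp del: upt_Suc)
  moreover have "{1..p} = set [1..<Suc p]" by auto
  ultimately show ?thesis by (simp only: prod.distinct_set_conv_list distinct_upt)
qed

context eigen_module
begin

text \<open>
  The coefficient at \<open>I\<close> of the left side is the sum over all lists of monomials in the expansion of
  the tensor of products of divided differences, to which \<open>\<theta>\<close> is applied; by multilinearity it is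
  the product of the operators applied to the single factors.
\<close>

lemma Psi_star_formula:
  assumes f: "\<forall>k\<le>p. f k \<in> Sym n"
  shows "tensor_map G Act (Psi n) (bar_chain (single g (f 0)) (map f [1..<Suc p])) =
    (\<Sum>I\<in>incr n p. single I (single g (f 0 *
       (\<Prod>k=1..p. sym_ext scale n v (s_prefix scale n v \<epsilon> (I ! (k - 1))) (qpartial scale n v \<epsilon> (I ! (k - 1)) (f k))))))"
    (is "?l = (\<Sum>I\<in>_. single I (single g (f 0 * ?P I)))")
proof -
  define fs where "fs = map f [1..<Suc p]"
  define t where "t = tensor_list fs"
  define y where "y = bar_chain (single g (f 0)) fs"
  have len: "length fs = p" and fs: "set fs \<subseteq> Sym n" using f by (auto simp: fs_def)
  have keys_t: "keys t \<subseteq> mon_lists n p" using keys_tensor_list[OF fs] by (simp add: t_def len)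
  have lookup_y: "lookup y ms = single g (cst (lookup t ms) * f 0)" for ms
    unfolding y_def bar_chain_def t_def[symmetric] lookup_sum lookup_single
    by (auto simp: when_def sum.delta in_keys_iff cong: if_cong)
  have keys_y: "keys y \<subseteq> keys t" by (auto simp: in_keys_iff lookup_y)
  have y: "y \<in> chains (mon_lists n p)"
    using keys_y keys_t f by (auto simp: free_on_def lookup_y Sym_at_def intro!: imageI Sym_mult Sym_cst)
  have coef_y: "coef y ms = cst (lookup t ms) * f 0" for ms by (simp add: coef_def lookup_y)
  have chain: "tensor_map G Act (psi n) y \<in> chains (incr n p)" by (rule psi_chains[OF y])
  have "tensor_map G Act (psi n) y = (\<Sum>I\<in>incr n p. single I (single g (f 0 * ?P I)))"
  proof (rule poly_mapping_eqI)
    fix I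
    have rhs: "lookup (\<Sum>I\<in>incr n p. single I (single g (f 0 * ?P I))) I =
        (if I \<in> incr n p then single g (f 0 * ?P I) else 0)"
      by (auto simp: lookup_sum lookup_single when_def sum.delta cong: if_cong)
    show "lookup (tensor_map G Act (psi n) y) I = lookup (\<Sum>I\<in>incr n p. single I (single g (f 0 * ?P I))) I"
    proof (cases "I \<in> incr n p")
      case False
      then show ?thesis using chain unfolding rhs by (auto simp: free_on_def in_keys_iff)
    next
      case I: True
      then have lenI: "length I = p" and setI: "set I \<subseteq> {1..n}" by (auto simp: incr_def)
      have \<theta>_coef: "\<theta> (lookup (psi_gen n ms) I) = prod_list (map2 (\<lambda>i m. \<theta> (divdiff n i m)) I ms)"
        if "ms \<in> keys t" for ms
      proof -
        have "length ms = p" using that keys_t by (auto simp: mon_lists_def)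
        then have "lookup (psi_gen n ms) I = prod_list (map2 (divdiff n) I ms)"
          using I by (simp add: psi_gen_def lookup_sum lookup_single when_def sum.delta cong: if_cong)
        moreover have "\<theta> (prod_list xs) = prod_list (map \<theta> xs)" for xs
          by (induction xs) (simp_all add: \<theta>_one \<theta>_mult)
        ultimately show ?thesis by (simp add: comp_def case_prod_unfold)
      qed
      have "coef (tensor_map G Act (psi n) y) I =
          (\<Sum>ms\<in>keys t. prod_list (map2 (\<lambda>i m. \<theta> (divdiff n i m)) I ms) * (cst (lookup t ms) * f 0))"
        by (simp add: coef_tensor_map[OF y finite_keys keys_y] \<theta>_coef coef_y)
      also have "\<dots> = f 0 * (\<Sum>ms\<in>keys t. cst (lookup t ms) * prod_list (map2 (\<lambda>i m. \<theta> (divdiff n i m)) I ms))"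
        by (simp add: sum_distrib_left ac_simps)
      also have "\<dots> = f 0 * (\<Prod>k=1..p. \<Sum>\<alpha>\<in>keys (f k). cst (lookup (f k) \<alpha>) * \<theta> (divdiff n (I ! (k - 1)) \<alpha>))"
        unfolding t_def tensor_list_expand[of I fs, unfolded len, OF lenI]
        unfolding fs_def prod_list_map2_upt[OF lenI] ..
      also have "(\<Prod>k=1..p. \<Sum>\<alpha>\<in>keys (f k). cst (lookup (f k) \<alpha>) * \<theta> (divdiff n (I ! (k - 1)) \<alpha>)) = ?P I"
      proof (rule prod.cong[OF refl])
        fix k assume k: "k \<in> {1..p}"
        then have i: "I ! (k - 1) \<in> {1..n}" using incr_nth[OF I, of "k - 1"] by auto
        have fk: "f k \<in> Sym n" using f k by auto
        show "(\<Sum>\<alpha>\<in>keys (f k). cst (lookup (f k) \<alpha>) * \<theta> (divdiff n (I ! (k - 1)) \<alpha>)) =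
          sym_ext scale n v (s_prefix scale n v \<epsilon> (I ! (k - 1))) (qpartial scale n v \<epsilon> (I ! (k - 1)) (f k))"
          unfolding sym_ext_s_prefix qpartial_eq[OF i fk] scale_vars_qdiff[OF i, where e = \<epsilon>] \<theta>_divdiff[OF i] ..
      qed
      finally show ?thesis
        unfolding rhs chains_lookup(1)[OF chain] using I by simp
    qed
  qed
  with Psi_eq_psi[OF y] show ?thesis unfolding y_def fs_def by (rule trans)
qed

end

theorem theorem6p4:
  fixes G :: "('g, 'b) monoid_scheme"
    and scale :: "complex \<Rightarrow> 'v::ab_group_add \<Rightarrow> 'v"
    and \<rho> :: "'g \<Rightarrow> 'v \<Rightarrow> 'v"
    and g :: 'g
    and n :: nat
    and v :: "nat \<Rightarrow> 'v"
    and \<epsilon> :: "nat \<Rightarrow> complex"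
    and A :: "'g \<Rightarrow> pol \<Rightarrow> pol"
    and Psi_star :: "(mon list \<Rightarrow>\<^sub>0 'g skew) \<Rightarrow> (nat list \<Rightarrow>\<^sub>0 'g skew)"
    and bar_d :: "(mon list \<Rightarrow>\<^sub>0 'g skew) \<Rightarrow> (mon list \<Rightarrow>\<^sub>0 'g skew)"
    and koszul_d :: "(nat list \<Rightarrow>\<^sub>0 'g skew) \<Rightarrow> (nat list \<Rightarrow>\<^sub>0 'g skew)"
  assumes module: "CG_module G scale \<rho>"
    and g: "g \<in> carrier G"
    and basis: "eigenbasis scale (\<rho> g) n v \<epsilon>"
    and A: "A = (\<lambda>h. sym_ext scale n v (\<rho> h))"
    and Psi_star: "Psi_star = tensor_map G A (Psi n)"
    and bar_d: "bar_d = tensor_map G A bar_diff"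
    and koszul_d: "koszul_d = tensor_map G A koszul_diff"
  shows "is_chain_map (bar_chains n g) bar_d (koszul_chains n g) koszul_d Psi_star \<and>
    (\<forall>p. induced (koszul_chains n g) koszul_d p Psi_star
           \<in> iso (homology (bar_chains n g) bar_d p) (homology (koszul_chains n g) koszul_d p)) \<and>
    (\<forall>p (f :: nat \<Rightarrow> pol). (\<forall>k\<le>p. f k \<in> Sym n) \<longrightarrow>
       Psi_star (bar_chain (Poly_Mapping.single g (f 0)) (map f [1..<Suc p])) =
         (\<Sum>I\<in>incr n p. Poly_Mapping.single I (Poly_Mapping.single g
            (f 0 * (\<Prod>k=1..p. sym_ext scale n v (s_prefix scale n v \<epsilon> (I ! (k - 1)))
                                 (qpartial scale n v \<epsilon> (I ! (k - 1)) (f k)))))))"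
proof -
  interpret eigen_module G scale \<rho> g n v \<epsilon>
    by (intro eigen_module.intro eigen_module_axioms.intro module g basis)
  show ?thesis
    unfolding Psi_star bar_d koszul_d A
    by (intro conjI allI impI Psi_star_is_chain_map Psi_star_induced_iso)
      (erule Psi_star_formula)
qed

end
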